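(* Fix $\eta \in (1/2,1)$. Let $\{L_n\}$ be a nondecreasing sequence for which $L_1 \geq L_0'$, where $L_0' = L_0'(K_0,K_1,M_0,\eta)$ is a constant, and assume that $\sum_n L_n^{-\frac12(1-\eta)} < \infty$. Then there is a constant $C = C(K_0,K_1,M_0,\eta)$, depending only on $K_0, K_1, M_0, \eta$, for which the following holds. Let $\alpha \in (0,1]$ and let $\varphi, \psi$ be $\alpha$-Hölder continuous functions on $\mathbb{T}^2$. Then $$\left| \int \psi \circ F^n \cdot \varphi - \int \varphi \int \psi \right| \leq C \|\psi\|_\alpha \|\varphi\|_\alpha \max\left\{ L_{\lfloor n/2\rfloor}^{1-2\eta},\ \Big( \sum_{i = \lfloor n/8 \rfloor}^\infty L_i^{-\frac12(1-\eta)} \Big)^{\frac{\alpha}{\alpha+2}} \right\}$$ for all $n \geq 0$.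
   Context: Setting. $\mathbb{T}^1 = \mathbb{R}/\mathbb{Z}$ is parametrized by $[0,1)$, $\mathbb{T}^2 = \mathbb{R}^2/\mathbb{Z}^2$ carries the flat metric, and $d$ (respectively $d_{\mathbb{T}^2}$) denotes geodesic distance on $\mathbb{T}^1$ (respectively $\mathbb{T}^2$). Fix constants $M_0 \in \mathbb{N}$, $K_0, K_1 > 0$, and $L_0 > 0$, and let $\{L_n\}$ be a nondecreasing sequence of reals with $L_0 \leq L_1 \leq L_2 \leq \cdots$. For each $n \geq 1$ let $f_n : \mathbb{T}^1 \to \mathbb{R}$ be a $C^3$ function such that: (i) $\|f_n'\|_{C^0} + \|f_n''\|_{C^0} \leq K_0 L_n$; (ii) $\mathcal{C}_n := \{\hat x \in \mathbb{T}^1 : f_n'(\hat x) = 0\}$ is finite with cardinality $\leq M_0$; (iii) $|f_n'(x)| \geq L_n K_1^{-1} d(x, \mathcal{C}_n)$ for all $x \in \mathbb{T}^1$. Define $F_n : \mathbb{T}^2 \to \mathbb{T}^2$ by $F_n(x,y) = (f_n(x) - y \ (\mathrm{mod}\ 1),\, x)$, and set $F^n = F_n \circ F_{n-1} \circ \cdots \circ F_1$ for $n \geq 1$ and $F^0 = \mathrm{Id}$. All integrals are with respect to Lebesgue measure on $\mathbb{T}^2$. For $\alpha \in (0,1]$, $[\varphi]_\alpha = \sup_{p \neq q \in \mathbb{T}^2} \frac{|\varphi(p)-\varphi(q)|}{d_{\mathbb{T}^2}(p,q)^\alpha}$ and $\|\varphi\|_\alpha = \|\varphi\|_{C^0} +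 [\varphi]_\alpha$.
   Formalization: For n = 0 and n = 1 the constant C may also depend on L_0 (no constant independent of L_0 works there: take φ = ψ = cos 2πx at n = 0 and let L_0 grow); for all n ≥ 2, C depends only on K_0, K_1, M_0, η as stated. *)

theory Defs
  imports "HOL-Analysis.Analysis"
begin

text \<open>
  The circle and the torus are represented by their fundamental domains; functions on the circle
  that are differentiated are 1-periodic functions on the line.
\<close>

definition circle :: "real set" where
  "circle = {0..<1}"

definition torus :: "(real \<times> real) set" where
  "torus = circle \<times> circle"

text \<open>
  Geodesic distances of the flat metrics: minimal Euclidean distance between lifts.
\<close>

definition circle_dist :: "real \<Rightarrow> real \<Rightarrow> real" where
  "circle_dist x y = (INF k\<in>\<int>. dist x (y + k))"

definition torus_dist :: "real \<times> real \<Rightarrow> real \<times> real \<Rightarrow> real" where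
  "torus_dist p q = (INF v\<in>\<int> \<times> \<int>. dist p (q + v))"

definition sup_norm_on :: "'a set \<Rightarrow> ('a \<Rightarrow> real) \<Rightarrow> real" where
  "sup_norm_on S g = (SUP x\<in>S. \<bar>g x\<bar>)"

definition C3_circle :: "(real \<Rightarrow> real) \<Rightarrow> bool" where
  "C3_circle f \<longleftrightarrow>
     (\<forall>x. f (x + 1) = f x) \<and>
     (\<forall>k<3. \<forall>x. ((deriv ^^ k) f) differentiable (at x)) \<and>
     continuous_on UNIV ((deriv ^^ 3) f)"

definition crit :: "(real \<Rightarrow> real) \<Rightarrow> real set" where
  "crit f = {x \<in> circle. deriv f x = 0}"

text \<open>
  The infimum in the last clause is never taken over the empty set: a differentiable periodic
  function has a critical point.
\<close>

definition map_hyps :: "nat \<Rightarrow> real \<Rightarrow> real \<Rightarrow> real \<Rightarrow> (real \<Rightarrow> real) \<Rightarrow> bool" where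
  "map_hyps M\<^sub>0 K\<^sub>0 K\<^sub>1 l f \<longleftrightarrow>
     C3_circle f \<and>
     sup_norm_on circle (deriv f) + sup_norm_on circle (deriv (deriv f)) \<le> K\<^sub>0 * l \<and>
     finite (crit f) \<and> card (crit f) \<le> M\<^sub>0 \<and>
     (\<forall>x\<in>circle. \<bar>deriv f x\<bar> \<ge> l * inverse K\<^sub>1 * (INF c\<in>crit f. circle_dist x c))"

text \<open>
  The maps are indexed from 1, so \<open>f 0\<close> is irrelevant and \<open>L 0\<close> is a positive
  lower bound of the sequence that does not constrain the dynamics. As \<open>L 0\<close> may be
  arbitrarily large, no mixing bound that is small in \<open>1 / L 0\<close> can hold for zero or one
  iterations with a constant independent of \<open>L 0\<close>: for one iteration, an observable of the
  second coordinate pulls back to an observable of the first.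
\<close>

definition system_hyps ::
  "nat \<Rightarrow> real \<Rightarrow> real \<Rightarrow> (nat \<Rightarrow> real) \<Rightarrow> (nat \<Rightarrow> real \<Rightarrow> real) \<Rightarrow> bool" where
  "system_hyps M\<^sub>0 K\<^sub>0 K\<^sub>1 L f \<longleftrightarrow>
     L 0 > 0 \<and> incseq L \<and> (\<forall>n\<ge>1. map_hyps M\<^sub>0 K\<^sub>0 K\<^sub>1 (L n) (f n))"

definition torus_map :: "(real \<Rightarrow> real) \<Rightarrow> real \<times> real \<Rightarrow> real \<times> real" where
  "torus_map f = (\<lambda>(x, y). (frac (f x - y), x))"

fun torus_comp :: "(nat \<Rightarrow> real \<Rightarrow> real) \<Rightarrow> nat \<Rightarrow> real \<times> real \<Rightarrow> real \<times> real" where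
  "torus_comp f 0 = id"
| "torus_comp f (Suc n) = torus_map (f (Suc n)) \<circ> torus_comp f n"

definition torus_integral :: "(real \<times> real \<Rightarrow> real) \<Rightarrow> real" where
  "torus_integral g = set_lebesgue_integral lborel torus g"

definition holder_on_torus :: "real \<Rightarrow> (real \<times> real \<Rightarrow> real) \<Rightarrow> bool" where
  "holder_on_torus \<alpha> \<phi> \<longleftrightarrow>
     (\<exists>H. \<forall>p\<in>torus. \<forall>q\<in>torus. \<bar>\<phi> p - \<phi> q\<bar> \<le> H * torus_dist p q powr \<alpha>)"

definition holder_seminorm :: "real \<Rightarrow> (real \<times> real \<Rightarrow> real) \<Rightarrow> real" where
  "holder_seminorm \<alpha> \<phi> =
     (SUP (p, q) \<in> {(p, q). p \<in> torus \<and> q \<in> torus \<and> p \<noteq> q}.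
        \<bar>\<phi> p - \<phi> q\<bar> / torus_dist p q powr \<alpha>)"

definition holder_norm :: "real \<Rightarrow> (real \<times> real \<Rightarrow> real) \<Rightarrow> real" where
  "holder_norm \<alpha> \<phi> = sup_norm_on torus \<phi> + holder_seminorm \<alpha> \<phi>"

end

theory Submission
  imports Defs
begin

text \<open>
  Lift the maps to the plane. An orbit is then a sequence of reals with
  \<open>x\<^sub>j\<^sub>+\<^sub>1 = f\<^sub>j x\<^sub>j - x\<^sub>j\<^sub>-\<^sub>1\<close>, and the state at time \<open>j\<close> is \<open>(x\<^sub>j\<^sub>+\<^sub>1, x\<^sub>j)\<close>. Keep the second
  coordinate of the initial state fixed and let the first one, \<open>x\<close>, vary. As long as every
  \<open>\<bar>f\<^sub>j' x\<^sub>j\<bar>\<close> is at least \<open>L\<^sub>j\<^sup>\<eta>\<close>, each step multiplies the derivative of \<open>x\<^sub>j\<close> in \<open>x\<close> by at least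
  \<open>L\<^sub>j\<^sup>\<eta> / 2\<close>. So the horizontal circle is mapped to a curve that winds around the torus very
  often in the first coordinate while the second coordinate hardly moves, and along such a curve
  an observable \<open>\<psi>\<close> may be replaced by its mean over the first coordinate. The second
  coordinate at time \<open>n\<close> is the first coordinate at time \<open>n - 1\<close>, so doing this once more, at
  time \<open>n - 1\<close>, replaces that mean by the integral of \<open>\<psi>\<close>. This gives decorrelation
  (\<open>correlation_decay\<close>).

  The replacement is an integration by parts (\<open>oscillatory_integral_bound\<close>) rather than a
  partition into monotone branches. Write \<open>\<psi>\<close> minus its mean as a partial derivative
  \<open>\<partial>\<^sub>u F\<close> with \<open>F\<close> periodic and bounded (\<open>potential_exists\<close>). With a smooth cutoff \<open>\<chi>\<close> supported
  where the expansion holds, \<open>\<chi> (\<partial>\<^sub>u F)(x\<^sub>k\<^sub>+\<^sub>1, x\<^sub>k)\<close> is \<open>\<chi> / x\<^sub>k\<^sub>+\<^sub>1'\<close> times the \<open>x\<close>-derivative of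
  \<open>F (x\<^sub>k\<^sub>+\<^sub>1, x\<^sub>k)\<close>, up to an error \<open>x\<^sub>k' / x\<^sub>k\<^sub>+\<^sub>1'\<close>. Everything is periodic in \<open>x\<close>, so there are no boundary
  terms, and what remains is controlled by the derivative of the weight \<open>\<chi> / x\<^sub>k\<^sub>+\<^sub>1'\<close>. Both the
  curvature \<open>x\<^sub>k\<^sub>+\<^sub>1'' / (x\<^sub>k\<^sub>+\<^sub>1')\<^sup>2\<close> and \<open>\<chi>' / x\<^sub>k\<^sub>+\<^sub>1'\<close> are of order \<open>L\<^sub>k\<^sup>1\<^sup>-\<^sup>2\<^sup>\<eta>\<close> (\<open>ddorb_bound\<close>,
  \<open>dchi_bound\<close>), which is the first term of the estimate. Removing the cutoff costs the measure of
  the set where some \<open>\<bar>f\<^sub>j' x\<^sub>j\<bar>\<close> is small. Every map preserves Lebesgue measure, so this is at most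
  the sum over \<open>j\<close> of \<open>L\<^sub>j\<^sup>\<eta>\<^sup>-\<^sup>1\<close> times a constant, since \<open>f\<^sub>j'\<close> is small only near its few zeros.

  This sum is small only if it starts late. Hence the argument is run from time
  \<open>m = n div 8\<close> on, with \<open>\<phi>\<close> transported to time \<open>m\<close> (\<open>cell_integral_transport\<close>). The
  transported function may oscillate on a scale smaller by the factor \<open>\<Prod>i\<le>m. K\<^sub>0 L\<^sub>i + 1\<close>, but
  about \<open>7 m\<close> expanding steps are left, and since \<open>\<eta> > 1/2\<close> their expansion wins
  (\<open>expansion_beats_contraction\<close>). Finally, Hoelder functions are not differentiable, so \<open>\<phi>\<close> and
  \<open>\<psi>\<close> are averaged at a scale \<open>\<epsilon>\<close>. If \<open>S\<close> is the tail sum of the statement, the choice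
  \<open>\<epsilon> = S powr (1 / (\<alpha> + 2))\<close> makes the error \<open>\<epsilon> powr \<alpha>\<close> equal to the second term of the estimate,
  and the loss \<open>1 / \<epsilon>\<close> in the derivatives is paid by the expansion, which gains \<open>S\<^sup>2\<close>.
\<close>

section \<open>Continuous periodic functions of one and two variables\<close>

text \<open>
  Functions on the circle and the torus are handled through their periodic lifts, for which
  continuity across the boundary of the fundamental domain is ordinary continuity.
\<close>

definition circle_fun :: "(real \<Rightarrow> real) \<Rightarrow> bool" where
  "circle_fun h \<longleftrightarrow> continuous_on UNIV h \<and> (\<forall>x. h (x + 1) = h x)"

definition torus_fun :: "(real \<times> real \<Rightarrow> real) \<Rightarrow> bool" where
  "torus_fun H \<longleftrightarrow> continuous_on UNIV H \<and>
     (\<forall>x y. H (x + 1, y) = H (x, y)) \<and> (\<forall>x y. H (x, y + 1) = H (x, y))"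

lemma periodic_int_shift:
  fixes h :: "real \<Rightarrow> 'b"
  assumes "\<And>x. h (x + 1) = h x"
  shows "h (x + of_int k) = h x"
proof -
  have nat: "h (z + of_nat n) = h z" for z n
  proof (induction n)
    case (Suc n)
    have "h (z + of_nat (Suc n)) = h ((z + of_nat n) + 1)" by (simp add: algebra_simps)
    then show ?case using assms Suc by simp
  qed simp
  show ?thesis
  proof (cases "k \<ge> 0")
    case True
    then show ?thesis using nat[of x "nat k"] by simp
  next
    case False
    then show ?thesis using nat[of "x + of_int k" "nat (- k)"] by simp
  qed
qed

lemma circle_fun_int_shift: "circle_fun h \<Longrightarrow> h (x + of_int k) = h x"
  using periodic_int_shift[of h] by (simp add: circle_fun_def)

lemma torus_fun_int_shift:
  assumes "torus_fun H"
  shows "H (x + of_int a, y + of_int b) = H (x, y)"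
  using assms periodic_int_shift[of "\<lambda>t. H (t, y + of_int b)" x a]
    periodic_int_shift[of "\<lambda>t. H (x, t)" y b] by (simp add: torus_fun_def)

lemma torus_fun_arith:
  assumes "torus_fun F" "torus_fun G"
  shows "torus_fun (\<lambda>p. F p * G p)" "torus_fun (\<lambda>p. F p - G p)"
  using assms by (auto simp: torus_fun_def intro!: continuous_intros)

lemma continuous_compose_UNIV:
  assumes "continuous_on UNIV h" "continuous_on S u"
  shows "continuous_on S (\<lambda>x. h (u x))"
  using continuous_on_compose2[OF assms(1,2)] by simp

lemma continuous_compose_pair:
  assumes "continuous_on UNIV h" "continuous_on S u" "continuous_on S v"
  shows "continuous_on S (\<lambda>x. h (u x, v x))"
  using continuous_compose_UNIV[OF assms(1) continuous_on_Pair[OF assms(2,3)]] .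

lemma torus_fun_cont:
  assumes "torus_fun H" "continuous_on S u" "continuous_on S v"
  shows "continuous_on S (\<lambda>x. H (u x, v x))"
  using continuous_compose_pair assms by (auto simp: torus_fun_def)

lemma torus_fun_cont_case:
  assumes "torus_fun (\<lambda>(x, y). F x y)" "continuous_on S u" "continuous_on S v"
  shows "continuous_on S (\<lambda>x. F (u x) (v x))"
  using torus_fun_cont[OF assms] by simp

lemma circle_fun_cont:
  assumes "circle_fun h" "continuous_on S u"
  shows "continuous_on S (\<lambda>x. h (u x))"
  using continuous_compose_UNIV assms by (auto simp: circle_fun_def)

lemma continuous_integral_param:
  fixes F :: "real \<times> real \<Rightarrow> real \<Rightarrow> real"
  assumes "continuous_on UNIV (\<lambda>q. F (fst q) (snd q))"
  shows "continuous_on S (\<lambda>p. integral {a..b} (F p))"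
proof -
  have "continuous_on UNIV (\<lambda>p. integral (cbox a b) (F p))"
    by (rule integral_continuous_on_param)
      (use assms in \<open>auto intro: continuous_on_subset simp: case_prod_unfold\<close>)
  then show ?thesis using continuous_on_subset by fastforce
qed

subsection \<open>Primitives and moving averages\<close>

text \<open>
  The primitive vanishing at 0. Scaling the integral to the unit interval makes the formula correct
  for negative arguments too, and makes the primitive jointly continuous in \<open>u\<close> and in any
  parameter on which \<open>f\<close> depends continuously.
\<close>

definition prim :: "(real \<Rightarrow> real) \<Rightarrow> real \<Rightarrow> real" where
  "prim f u = u * integral {0..1} (\<lambda>t. f (t * u))"

lemma prim_has_derivative:
  assumes f: "continuous_on UNIV f"
  shows "(prim f has_real_derivative f u) (at u)"
proof -
  define M where "M = \<bar>u\<bar> + 1"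
  obtain Q where Q: "\<And>x. x \<in> {-M..M} \<Longrightarrow> (Q has_vector_derivative f x) (at x within {-M..M})"
    using antiderivative_continuous[of "-M" M f] continuous_on_subset[OF f] by auto
  have eq: "prim f x = Q x - Q 0" if x: "x \<in> {-M..M}" for x
  proof -
    have tx: "t * x \<in> {-M..M}" if "t \<in> {0..1}" for t
    proof -
      have "\<bar>t * x\<bar> \<le> 1 * \<bar>x\<bar>" using that unfolding abs_mult by (intro mult_right_mono) auto
      then show ?thesis using x by auto
    qed
    have "((\<lambda>t. Q (t * x)) has_vector_derivative x * f (t * x)) (at t within {0..1})"
      if t: "t \<in> {0..1}" for t
    proof -
      have "((Q \<circ> (\<lambda>t. t * x)) has_vector_derivative x *\<^sub>R f (t * x)) (at t within {0..1})"
      proof (rule vector_diff_chain_within)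
        show "((\<lambda>t. t * x) has_vector_derivative x) (at t within {0..1})"
          by (auto intro!: derivative_eq_intros simp flip: has_real_derivative_iff_has_vector_derivative)
        show "(Q has_vector_derivative f (t * x)) (at (t * x) within (\<lambda>t. t * x) ` {0..1})"
          by (rule has_vector_derivative_within_subset[OF Q[OF tx[OF t]]]) (use tx in auto)
      qed
      then show ?thesis by (simp add: o_def)
    qed
    then have "((\<lambda>t. x * f (t * x)) has_integral (Q (1 * x) - Q (0 * x))) {0..1}"
      by (intro fundamental_theorem_of_calculus) auto
    then show ?thesis by (simp add: prim_def integral_unique flip: integral_mult_right)
  qed
  have "(Q has_real_derivative f u) (at u within {-M..M})"
    unfolding has_real_derivative_iff_has_vector_derivative by (rule Q) (auto simp: M_def)
  then have "(Q has_real_derivative f u) (at u)"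
    using at_within_Icc_at[of "-M" u M] by (simp add: M_def)
  then have "((\<lambda>x. Q x - Q 0) has_real_derivative f u) (at u)"
    by (auto intro!: derivative_eq_intros)
  then show ?thesis
  proof (rule DERIV_cong_ev[THEN iffD1, rotated -1, OF _ refl _ refl])
    have "\<forall>\<^sub>F x in nhds u. x \<in> {-M<..<M}"
      by (intro eventually_nhds_in_open) (auto simp: M_def)
    then show "\<forall>\<^sub>F x in nhds u. Q x - Q 0 = prim f x"
      by eventually_elim (use eq in auto)
  qed
qed

lemma integral_eq_prim:
  assumes f: "continuous_on UNIV f" and "a \<le> b"
  shows "integral {a..b} f = prim f b - prim f a"
proof -
  have "(f has_integral (prim f b - prim f a)) {a..b}"
    using assms(2) prim_has_derivative[OF f]
    by (intro fundamental_theorem_of_calculus)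
      (auto simp flip: has_real_derivative_iff_has_vector_derivative intro: has_field_derivative_at_within)
  then show ?thesis by (rule integral_unique)
qed

lemma prim_translate_derivative:
  assumes f: "continuous_on UNIV f"
  shows "((\<lambda>t. prim f (v + t)) has_real_derivative f (v + t)) (at t within S)"
    and "((\<lambda>t. - prim f (v - t)) has_real_derivative f (v - t)) (at t within S)"
proof -
  have "((\<lambda>t. v + t) has_real_derivative 1) (at t)" "((\<lambda>t. v - t) has_real_derivative -1) (at t)"
    by (auto intro!: derivative_eq_intros)
  note chain = this[THEN DERIV_chain2[OF prim_has_derivative[OF f]]]
  show "((\<lambda>t. prim f (v + t)) has_real_derivative f (v + t)) (at t within S)"
    using chain(1) by (auto intro: has_field_derivative_at_within)
  show "((\<lambda>t. - prim f (v - t)) has_real_derivative f (v - t)) (at t within S)"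
    using DERIV_minus[OF chain(2)] by (auto intro: has_field_derivative_at_within)
qed

lemma integral_translate:
  assumes f: "continuous_on UNIV f" and "a \<le> b"
  shows "integral {a..b} (\<lambda>t. f (v + t)) = prim f (v + b) - prim f (v + a)"
proof -
  have "((\<lambda>t. f (v + t)) has_integral (prim f (v + b) - prim f (v + a))) {a..b}"
    using assms(2)
    by (intro fundamental_theorem_of_calculus)
      (auto simp flip: has_real_derivative_iff_has_vector_derivative
        intro: prim_translate_derivative[OF f])
  then show ?thesis by (rule integral_unique)
qed

lemma integral_reflect_translate:
  assumes f: "continuous_on UNIV f" and "a \<le> b"
  shows "integral {a..b} (\<lambda>t. f (v - t)) = prim f (v - a) - prim f (v - b)"
proof -
  have "((\<lambda>t. f (v - t)) has_integral (- prim f (v - b) - - prim f (v - a))) {a..b}"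
    using assms(2)
    by (intro fundamental_theorem_of_calculus)
      (auto simp flip: has_real_derivative_iff_has_vector_derivative
        intro: prim_translate_derivative[OF f])
  then show ?thesis by (simp add: integral_unique)
qed

lemma prim_period:
  assumes h: "circle_fun h"
  shows "prim h (u + 1) = prim h u + integral {0..1} h"
proof -
  have c: "continuous_on UNIV h" using h by (simp add: circle_fun_def)
  have "((\<lambda>u. prim h (u + 1) - prim h u) has_real_derivative 0) (at u)" for u
    by (rule derivative_eq_intros refl DERIV_chain2[OF prim_has_derivative[OF c]]
        prim_has_derivative[OF c])+ (use h in \<open>auto simp: circle_fun_def\<close>)
  then have "prim h (u + 1) - prim h u = prim h (0 + 1) - prim h 0"
    using DERIV_isconst_all[of "\<lambda>u. prim h (u + 1) - prim h u"] by blast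
  then show ?thesis using integral_eq_prim[OF c, of 0 1] by simp
qed

text \<open>
  The one-dimensional reason why the maps preserve Lebesgue measure: on each vertical circle they act
  by a reflection.
\<close>

lemma integral_reflect_period:
  assumes h: "circle_fun h"
  shows "integral {0..1} (\<lambda>t. h (c - t)) = integral {0..1} h"
proof -
  have "continuous_on UNIV h" using h by (simp add: circle_fun_def)
  then have "integral {0..1} (\<lambda>t. h (c - t)) = prim h c - prim h (c - 1)"
    using integral_reflect_translate[of h 0 1 c] by simp
  moreover have "prim h c = prim h (c - 1) + integral {0..1} h"
    using prim_period[OF h, of "c - 1"] by (simp only: diff_add_cancel)
  ultimately show ?thesis by simp
qed

text \<open>
  Averaging turns a continuous function into a differentiable one, with an explicit derivative of
  order \<open>1 / d\<close> and an error of at most the oscillation of \<open>f\<close> at scale \<open>d\<close>.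
\<close>

definition moving_avg :: "real \<Rightarrow> (real \<Rightarrow> real) \<Rightarrow> real \<Rightarrow> real" where
  "moving_avg d f v = integral {0..d} (\<lambda>t. f (v + t)) / d"

lemma moving_avg_has_derivative:
  assumes f: "continuous_on UNIV f" and d: "0 < d"
  shows "(moving_avg d f has_real_derivative (f (v + d) - f v) / d) (at v)"
proof -
  have "moving_avg d f = (\<lambda>v. (prim f (v + d) - prim f v) / d)"
    using integral_translate[OF f, of 0 d] d by (simp add: moving_avg_def fun_eq_iff)
  moreover have "((\<lambda>v. (prim f (v + d) - prim f v) / d) has_real_derivative (f (v + d) - f v) / d) (at v)"
    by (rule derivative_eq_intros refl DERIV_chain2[OF prim_has_derivative[OF f]]
        prim_has_derivative[OF f])+ (use d in auto)
  ultimately show ?thesis by simp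
qed

lemma moving_avg_close:
  assumes f: "continuous_on UNIV f" and d: "0 < d"
    and b: "\<And>t. 0 \<le> t \<Longrightarrow> t \<le> d \<Longrightarrow> \<bar>f (v + t) - c\<bar> \<le> B"
  shows "\<bar>moving_avg d f v - c\<bar> \<le> B"
proof -
  have "((\<lambda>t. f (v + t)) has_integral (d * moving_avg d f v)) {0..d}"
    using d unfolding moving_avg_def
    by (auto intro!: integrable_integral integrable_continuous_real continuous_compose_UNIV[OF f]
        continuous_intros)
  from has_integral_diff[OF this has_integral_const_real[of c 0 d]]
  have "((\<lambda>t. f (v + t) - c) has_integral (d * moving_avg d f v - d * c)) {0..d}" using d by simp
  moreover have "0 \<le> B" using b[of 0] d by (smt (verit))
  ultimately have "norm (d * moving_avg d f v - d * c) \<le> B * measure lborel (cbox 0 d)"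
    using b by (intro has_integral_bound) auto
  then have "d * \<bar>moving_avg d f v - c\<bar> \<le> d * B"
    using d by (simp add: abs_mult mult.commute[of B] flip: right_diff_distrib)
  then show ?thesis using d by simp
qed

subsection \<open>Integration over the unit cell\<close>

abbreviation cell :: "(real \<times> real) set" where
  "cell \<equiv> cbox (0, 0) (1, 1)"

lemma cell_integrable: "continuous_on UNIV (H :: real \<times> real \<Rightarrow> real) \<Longrightarrow> H integrable_on cell"
  by (rule integrable_continuous) (erule continuous_on_subset, simp)

lemma cell_bound:
  assumes "continuous_on UNIV (H :: real \<times> real \<Rightarrow> real)" "continuous_on UNIV B"
    and "\<And>p. \<bar>H p\<bar> \<le> B p"
  shows "\<bar>integral cell H\<bar> \<le> integral cell B"
  using integral_norm_bound_integral[OF cell_integrable[OF assms(1)] cell_integrable[OF assms(2)]]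
    assms(3) by simp

lemma cell_const: "integral cell (\<lambda>p. c) = (c::real)"
  by (simp add: content_Pair)

lemma cell_fubini:
  assumes "continuous_on UNIV (H :: real \<times> real \<Rightarrow> real)"
  shows "integral cell H = integral {0..1} (\<lambda>x. integral {0..1} (\<lambda>y. H (x, y)))"
    and "integral cell H = integral {0..1} (\<lambda>y. integral {0..1} (\<lambda>x. H (x, y)))"
proof -
  have c: "continuous_on cell H" using continuous_on_subset[OF assms] by auto
  show 1: "integral cell H = integral {0..1} (\<lambda>x. integral {0..1} (\<lambda>y. H (x, y)))"
    using integral_prod_continuous[OF c] by simp
  show "integral cell H = integral {0..1} (\<lambda>y. integral {0..1} (\<lambda>x. H (x, y)))"
    unfolding 1 using integral_swap_continuous[of 0 0 1 1 "\<lambda>x y. H (x, y)"] c by simp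
qed

text \<open>
  The half-open fundamental domain and the closed unit square differ by a null set. On the closed
  square, Fubini's theorem for continuous functions makes measurability arguments superfluous.
\<close>

lemma torus_integral_eq_cell:
  assumes H: "continuous_on UNIV (H :: real \<times> real \<Rightarrow> real)"
    and eq: "\<And>p. p \<in> torus \<Longrightarrow> h p = H p"
  shows "torus_integral h = integral cell H"
proof -
  have sub: "torus \<subseteq> cell" by (auto simp: torus_def circle_def)
  have m: "torus \<in> sets lborel" unfolding torus_def circle_def by (simp add: borel_prod[symmetric])
  have "set_integrable lborel cell H"
    using continuous_on_subset[OF H] by (intro borel_integrable_compact[folded set_integrable_def] ) auto
  then have int: "set_integrable lborel torus H" using set_integrable_subset m sub by blast
  have "torus_integral h = set_lebesgue_integral lborel torus H"
    unfolding torus_integral_def using m eq by (intro set_lebesgue_integral_cong) auto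
  also have "\<dots> = integral torus H" using int by (rule set_borel_integral_eq_integral)
  also have "\<dots> = integral cell H"
  proof (rule integral_spike_set)
    have "cell - torus \<subseteq> cell - box (0, 0) (1, 1)"
      by (auto simp: torus_def circle_def box_def Basis_prod_def)
    then show "negligible {x \<in> cell - torus. H x \<noteq> 0}"
      by (intro negligible_subset[OF negligible_frontier_interval[of "(0,0)" "(1::real,1::real)"]]) auto
    show "negligible {x \<in> torus - cell. H x \<noteq> 0}"
      using sub by (auto intro: negligible_subset[OF negligible_empty])
  qed
  finally show ?thesis .
qed

lemma shear_invariance:
  assumes H: "torus_fun H" and f: "circle_fun f"
  shows "integral cell (\<lambda>(x, y). H (f x - y, x)) = integral cell H"
proof -
  have cH: "continuous_on UNIV H" using H by (simp add: torus_fun_def)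
  have "continuous_on UNIV (\<lambda>p. H (f (fst p) - snd p, fst p))"
    by (intro torus_fun_cont[OF H] continuous_intros circle_fun_cont[OF f])
  then have "integral cell (\<lambda>(x, y). H (f x - y, x)) =
      integral {0..1} (\<lambda>x. integral {0..1} (\<lambda>y. H (f x - y, x)))"
    by (subst cell_fubini(1)) (auto simp: case_prod_unfold)
  also have "\<dots> = integral {0..1} (\<lambda>x. integral {0..1} (\<lambda>y. H (y, x)))"
  proof (rule integral_cong)
    fix x :: real
    have "circle_fun (\<lambda>t. H (t, x))"
      using H unfolding circle_fun_def by (auto intro!: torus_fun_cont[OF H] continuous_intros simp: torus_fun_def)
    from integral_reflect_period[OF this]
    show "integral {0..1} (\<lambda>y. H (f x - y, x)) = integral {0..1} (\<lambda>y. H (y, x))" .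
  qed
  finally show ?thesis using cell_fubini(2)[OF cH] by simp
qed

section \<open>Orbits of the lifted maps\<close>

text \<open>
  The state at time \<open>j\<close> of the orbit that starts in \<open>(x, y)\<close> is the pair
  \<open>(orb g x y (Suc j), orb g x y j)\<close>. The values are real numbers, not reduced modulo 1, so that they
  can be differentiated in \<open>x\<close>.
\<close>

fun orb :: "(nat \<Rightarrow> real \<Rightarrow> real) \<Rightarrow> real \<Rightarrow> real \<Rightarrow> nat \<Rightarrow> real" where
  "orb g x y 0 = y"
| "orb g x y (Suc 0) = x"
| "orb g x y (Suc (Suc j)) = g (Suc j) (orb g x y (Suc j)) - orb g x y j"

text \<open>
  One application of the first map turns an orbit into an orbit of the shifted sequence of maps; the
  inductions over the number of maps rest on this.
\<close>

lemma orb_shift: "orb g x y (Suc j) = orb (\<lambda>i. g (Suc i)) (g 1 x - y) x j"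
  by (induction g x y j rule: orb.induct) auto

lemma orb_continuous:
  assumes "\<And>j. circle_fun (g (Suc j))" "continuous_on S u" "continuous_on S v"
  shows "continuous_on S (\<lambda>p. orb g (u p) (v p) j)"
proof -
  have "continuous_on S (\<lambda>p. orb g (u p) (v p) j) \<and> continuous_on S (\<lambda>p. orb g (u p) (v p) (Suc j))"
    by (induction j) (auto intro!: assms continuous_intros circle_fun_cont[OF assms(1)])
  then show ?thesis ..
qed

lemma orb_int_shift:
  assumes g: "\<And>j. circle_fun (g (Suc j))"
  obtains k :: int where "orb g (x + of_int a) (y + of_int b) j = orb g x y j + of_int k"
proof -
  have "(\<exists>k::int. orb g (x + of_int a) (y + of_int b) j = orb g x y j + of_int k) \<and>
     (\<exists>k::int. orb g (x + of_int a) (y + of_int b) (Suc j) = orb g x y (Suc j) + of_int k)"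
  proof (induction j)
    case 0
    then show ?case by auto
  next
    case (Suc j)
    then obtain k l :: int where
      "orb g (x + of_int a) (y + of_int b) j = orb g x y j + of_int k"
      "orb g (x + of_int a) (y + of_int b) (Suc j) = orb g x y (Suc j) + of_int l" by blast
    then have "orb g (x + of_int a) (y + of_int b) (Suc (Suc j)) =
        orb g x y (Suc (Suc j)) + of_int (- k)"
      by (simp add: circle_fun_int_shift[OF g])
    then show ?case using Suc by blast
  qed
  then show thesis using that by blast
qed

lemma torus_fun_orb:
  assumes g: "\<And>j. circle_fun (g (Suc j))" and H: "torus_fun H"
  shows "torus_fun (\<lambda>(x, y). H (orb g x y (Suc j), orb g x y j))"
  unfolding torus_fun_def
proof (intro conjI allI)
  show "continuous_on UNIV (\<lambda>(x, y). H (orb g x y (Suc j), orb g x y j))"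
    unfolding case_prod_unfold
    by (intro torus_fun_cont[OF H] orb_continuous g continuous_intros)
  have inv: "H (orb g (x + of_int a) (y + of_int b) (Suc j), orb g (x + of_int a) (y + of_int b) j) =
      H (orb g x y (Suc j), orb g x y j)" for x y and a b :: int
  proof -
    obtain k where "orb g (x + of_int a) (y + of_int b) j = orb g x y j + of_int k"
      using orb_int_shift[of g x a y b j] g by blast
    moreover obtain l where "orb g (x + of_int a) (y + of_int b) (Suc j) = orb g x y (Suc j) + of_int l"
      using orb_int_shift[of g x a y b "Suc j"] g by blast
    ultimately show ?thesis by (simp only: torus_fun_int_shift[OF H])
  qed
  show "(case (x + 1, y) of (x, y) \<Rightarrow> H (orb g x y (Suc j), orb g x y j)) =
      (case (x, y) of (x, y) \<Rightarrow> H (orb g x y (Suc j), orb g x y j))" for x y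
    using inv[of x 1 y 0] by simp
  show "(case (x, y + 1) of (x, y) \<Rightarrow> H (orb g x y (Suc j), orb g x y j)) =
      (case (x, y) of (x, y) \<Rightarrow> H (orb g x y (Suc j), orb g x y j))" for x y
    using inv[of x 0 y 1] by simp
qed

lemma torus_fun_of_circle_fun:
  assumes "circle_fun h"
  shows "torus_fun (\<lambda>p. h (fst p))" "torus_fun (\<lambda>p. h (snd p))"
  using assms
  by (auto simp: torus_fun_def circle_fun_def intro!: circle_fun_cont[OF assms] continuous_intros)

lemma cell_integral_orb:
  assumes g: "\<And>j. circle_fun (g (Suc j))" and H: "torus_fun H"
  shows "integral cell (\<lambda>(x, y). H (orb g x y (Suc j), orb g x y j)) = integral cell H"
  using g
proof (induction j arbitrary: g)
  case 0
  then show ?case by (simp add: case_prod_unfold)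
next
  case (Suc j)
  define h where "h = (\<lambda>i. g (Suc i))"
  have h: "\<And>j. circle_fun (h (Suc j))" using Suc.prems by (simp add: h_def)
  define G where "G = (\<lambda>(x, y). H (orb h x y (Suc j), orb h x y j))"
  have "integral cell (\<lambda>(x, y). H (orb g x y (Suc (Suc j)), orb g x y (Suc j))) =
      integral cell (\<lambda>(x, y). G (g 1 x - y, x))"
    unfolding orb_shift[of g _ _ j] orb_shift[of g _ _ "Suc j"] by (simp add: G_def h_def)
  also have "\<dots> = integral cell G"
    using torus_fun_orb[of h H j] h H Suc.prems[of 0] unfolding G_def by (intro shear_invariance) auto
  also have "\<dots> = integral cell H" unfolding G_def by (rule Suc.IH) (rule h)
  finally show ?case .
qed

lemma cell_integral_orb1:
  assumes g: "\<And>j. circle_fun (g (Suc j))" and h: "circle_fun h"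
  shows "integral cell (\<lambda>(x, y). h (orb g x y j)) = integral {0..1} h"
proof -
  have "integral cell (\<lambda>(x, y). h (orb g x y j)) = integral cell (\<lambda>p. h (snd p))"
    using cell_integral_orb[of g, OF g torus_fun_of_circle_fun(2)[OF h], of j] by simp
  also have "\<dots> = integral {0..1} h"
    using torus_fun_of_circle_fun(2)[OF h] by (subst cell_fubini(1)) (auto simp: torus_fun_def)
  finally show ?thesis .
qed

text \<open>
  The observable \<open>\<phi>\<close> seen from time \<open>m\<close>, that is, composed with the inverse of the first \<open>m\<close> maps. The
  lift \<open>(x, y) \<mapsto> (f x - y, x)\<close> has the inverse \<open>(x, y) \<mapsto> (y, f y - x)\<close>.
\<close>

fun pullback :: "(nat \<Rightarrow> real \<Rightarrow> real) \<Rightarrow> (real \<times> real \<Rightarrow> real) \<Rightarrow> nat \<Rightarrow> real \<times> real \<Rightarrow> real" where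
  "pullback f \<phi> 0 = \<phi>"
| "pullback f \<phi> (Suc m) = (\<lambda>(x, y). pullback f \<phi> m (y, f (Suc m) y - x))"

lemma torus_fun_pullback:
  assumes f: "\<And>j. circle_fun (f (Suc j))" and \<phi>: "torus_fun \<phi>"
  shows "torus_fun (pullback f \<phi> m)"
proof (induction m)
  case 0
  then show ?case using \<phi> by simp
next
  case (Suc m)
  have cont: "continuous_on UNIV (pullback f \<phi> (Suc m))"
    by (simp add: case_prod_unfold)
      (intro torus_fun_cont[OF Suc] continuous_intros circle_fun_cont[OF f])
  have shift: "pullback f \<phi> m (y + 1, z - x) = pullback f \<phi> m (y, z - x)"
    "pullback f \<phi> m (y, z - (x + 1)) = pullback f \<phi> m (y, z - x)" for x y z
    using torus_fun_int_shift[OF Suc, of y 1 "z - x" 0] torus_fun_int_shift[OF Suc, of y 0 "z - x" "-1"]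
    by (simp_all add: algebra_simps)
  have "f (Suc m) (y + 1) = f (Suc m) y" for y using f[of m] by (simp add: circle_fun_def)
  with cont shift show ?case by (simp add: torus_fun_def)
qed

text \<open>
  Change of variables by the first \<open>m\<close> maps, one at a time by \<open>shear_invariance\<close>: correlations can be
  computed at time \<open>m\<close> instead of time 0.
\<close>

lemma cell_integral_transport:
  assumes f: "\<And>j. circle_fun (f (Suc j))" and \<phi>: "torus_fun \<phi>" and \<psi>: "torus_fun \<psi>"
  shows "integral cell (\<lambda>(x, y). \<psi> (orb f x y (Suc (m + k)), orb f x y (m + k)) * \<phi> (x, y)) =
    integral cell (\<lambda>(x, y). \<psi> (orb (\<lambda>j. f (m + j)) x y (Suc k), orb (\<lambda>j. f (m + j)) x y k) * pullback f \<phi> m (x, y))"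
proof (induction m arbitrary: k)
  case 0
  then show ?case by simp
next
  case (Suc m)
  define g where "g = (\<lambda>j. f (m + j))"
  define h where "h = (\<lambda>j. f (Suc m + j))"
  have g: "\<And>j. circle_fun (g (Suc j))" and h: "\<And>j. circle_fun (h (Suc j))"
    using f by (auto simp: g_def h_def)
  have gh: "(\<lambda>i. g (Suc i)) = h" by (simp add: g_def h_def)
  define G where "G = (\<lambda>(x, y). \<psi> (orb h x y (Suc k), orb h x y k) * pullback f \<phi> (Suc m) (x, y))"
  have G: "torus_fun G"
    using torus_fun_orb[of h \<psi> k, OF h \<psi>] torus_fun_pullback[of f \<phi> "Suc m", OF f \<phi>] unfolding torus_fun_def G_def
    by (auto simp del: pullback.simps orb.simps simp: case_prod_unfold intro!: continuous_intros)
  have "integral cell (\<lambda>(x, y). \<psi> (orb f x y (Suc (Suc m + k)), orb f x y (Suc m + k)) * \<phi> (x, y)) =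
    integral cell (\<lambda>(x, y). \<psi> (orb g x y (Suc (Suc k)), orb g x y (Suc k)) * pullback f \<phi> m (x, y))"
    using Suc[of "Suc k"] unfolding g_def by simp
  also have "\<dots> = integral cell (\<lambda>(x, y). G (g 1 x - y, x))"
    unfolding orb_shift[of g _ _ k] orb_shift[of g _ _ "Suc k"] gh by (simp add: G_def g_def)
  also have "\<dots> = integral cell G"
    using g[of 0] by (intro shear_invariance[OF G]) simp
  finally show ?case unfolding G_def h_def .
qed

lemma torus_comp_eq_orb:
  assumes f: "\<And>j. circle_fun (f (Suc j))" and p: "(x, y) \<in> torus"
  shows "torus_comp f n (x, y) = (frac (orb f x y (Suc n)), frac (orb f x y n))"
proof (induction n)
  case 0
  then show ?case using p by (auto simp: torus_def circle_def frac_eq)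
next
  case (Suc n)
  have "f (Suc n) (frac z) = f (Suc n) z" for z
    using circle_fun_int_shift[OF f[of n], of "frac z" "\<lfloor>z\<rfloor>"] by (simp add: frac_def)
  moreover have "frac (c - frac z) = frac (c - z)" for c z :: real
    by (rule frac_diff_simp)
  ultimately show ?case by (simp add: Suc torus_map_def)
qed

section \<open>Hoelder functions\<close>

definition torus_holder :: "real \<Rightarrow> real \<Rightarrow> (real \<times> real \<Rightarrow> real) \<Rightarrow> bool" where
  "torus_holder N \<alpha> H \<longleftrightarrow> torus_fun H \<and> (\<forall>p. \<bar>H p\<bar> \<le> N) \<and>
     (\<forall>p q. \<bar>H p - H q\<bar> \<le> N * dist p q powr \<alpha>)"

definition periodic_ext :: "(real \<times> real \<Rightarrow> real) \<Rightarrow> real \<times> real \<Rightarrow> real" where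
  "periodic_ext \<phi> = (\<lambda>(x, y). \<phi> (frac x, frac y))"

lemma torus_dist_nonneg: "0 \<le> torus_dist p q"
  unfolding torus_dist_def by (intro cINF_greatest) (auto intro: exI[of _ 0])

lemma torus_dist_frac_le: "torus_dist (frac x, frac y) (frac x', frac y') \<le> dist (x, y) (x', y')"
proof -
  define v :: "real \<times> real" where "v = (of_int (\<lfloor>x'\<rfloor> - \<lfloor>x\<rfloor>), of_int (\<lfloor>y'\<rfloor> - \<lfloor>y\<rfloor>))"
  have "torus_dist (frac x, frac y) (frac x', frac y') \<le> dist (frac x, frac y) ((frac x', frac y') + v)"
    unfolding torus_dist_def
    by (intro cINF_lower bdd_belowI2[of _ 0]) (auto simp: v_def simp flip: of_int_diff)
  also have "\<dots> = dist (x, y) (x', y')"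
    by (simp add: dist_Pair_Pair dist_real_def v_def frac_def)
  finally show ?thesis .
qed

text \<open>
  The torus distance of two reduced points is at most the distance of the points themselves, so the
  Hoelder condition on the fundamental domain passes to the periodic extension with the same
  constant. The suprema in the norms are over bounded sets because the torus has finite diameter.
\<close>

lemma torus_holder_periodic_ext:
  assumes \<phi>: "holder_on_torus \<alpha> \<phi>" and \<alpha>: "0 < \<alpha>"
  shows "torus_holder (holder_norm \<alpha> \<phi>) \<alpha> (periodic_ext \<phi>)" and "0 \<le> holder_norm \<alpha> \<phi>"
proof -
  obtain H where H: "\<And>p q. p \<in> torus \<Longrightarrow> q \<in> torus \<Longrightarrow> \<bar>\<phi> p - \<phi> q\<bar> \<le> H * torus_dist p q powr \<alpha>"
    using \<phi> unfolding holder_on_torus_def by blast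
  have frac_in: "(frac x, frac y) \<in> torus" for x y :: real
    by (auto simp: torus_def circle_def frac_lt_1)
  have frac_id: "frac x = x" "frac y = y" if "(x, y) \<in> torus" for x y :: real
    using that by (auto simp: torus_def circle_def frac_eq)
  have td2: "torus_dist p q \<le> 2" if "p \<in> torus" "q \<in> torus" for p q
  proof -
    obtain x y x' y' where pq: "p = (x, y)" "q = (x', y')" by (cases p, cases q)
    have "torus_dist p q \<le> dist p q"
      using torus_dist_frac_le[of x y x' y'] that frac_id unfolding pq by simp
    also have "\<dots> \<le> \<bar>x - x'\<bar> + \<bar>y - y'\<bar>"
      unfolding pq dist_Pair_Pair dist_real_def by (rule order_trans[OF sqrt_sum_squares_le_sum_abs]) simp
    also have "\<dots> \<le> 2" using that unfolding pq torus_def circle_def by auto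
    finally show ?thesis .
  qed
  have zero: "(0, 0) \<in> torus" by (simp add: torus_def circle_def)
  have bdd: "bdd_above ((\<lambda>p. \<bar>\<phi> p\<bar>) ` torus)"
  proof (rule bdd_aboveI2)
    fix p assume p: "p \<in> torus"
    have "H * torus_dist p (0, 0) powr \<alpha> \<le> \<bar>H\<bar> * 2 powr \<alpha>"
      using td2[OF p zero] \<alpha> torus_dist_nonneg by (intro mult_mono powr_mono2) auto
    then show "\<bar>\<phi> p\<bar> \<le> \<bar>\<phi> (0, 0)\<bar> + \<bar>H\<bar> * 2 powr \<alpha>"
      using H[OF p zero] by linarith
  qed
  let ?D = "{(p, q). p \<in> torus \<and> q \<in> torus \<and> p \<noteq> q}"
  let ?r = "\<lambda>(p, q). \<bar>\<phi> p - \<phi> q\<bar> / torus_dist p q powr \<alpha>"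
  have bdd_r: "bdd_above (?r ` ?D)"
  proof (rule bdd_aboveI2)
    fix d assume "d \<in> ?D"
    then obtain p q where d: "d = (p, q)" "p \<in> torus" "q \<in> torus" by auto
    show "?r d \<le> \<bar>H\<bar>"
    proof (cases "torus_dist p q = 0")
      case False
      then have "torus_dist p q powr \<alpha> > 0" using torus_dist_nonneg[of p q] by simp
      then show ?thesis using H[OF d(2,3)] d(1)
        by (simp add: divide_le_eq)
          (rule order_trans[OF _ mult_right_mono[OF abs_ge_self powr_ge_zero]], simp)
    qed (simp add: d)
  qed
  have S: "\<bar>\<phi> p\<bar> \<le> sup_norm_on torus \<phi>" if "p \<in> torus" for p
    unfolding sup_norm_on_def using that bdd by (rule cSUP_upper)
  have semi: "?r d \<le> holder_seminorm \<alpha> \<phi>" if "d \<in> ?D" for d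
    unfolding holder_seminorm_def using that bdd_r by (rule cSUP_upper)
  have semi0: "0 \<le> holder_seminorm \<alpha> \<phi>"
    by (rule order_trans[OF _ semi[of "((0, 0), (1/2, 0))"]]) (auto simp: torus_def circle_def)
  have sup0: "0 \<le> sup_norm_on torus \<phi>" using S[OF zero] by linarith
  show nn: "0 \<le> holder_norm \<alpha> \<phi>" using sup0 semi0 by (simp add: holder_norm_def)
  have le1: "\<bar>\<phi> p\<bar> \<le> holder_norm \<alpha> \<phi>" if "p \<in> torus" for p
    using S[OF that] semi0 by (simp add: holder_norm_def)
  have le2: "\<bar>\<phi> p - \<phi> q\<bar> \<le> holder_norm \<alpha> \<phi> * torus_dist p q powr \<alpha>"
    if pq: "p \<in> torus" "q \<in> torus" for p q
  proof (cases "torus_dist p q = 0")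
    case True
    then show ?thesis using H[OF pq] by simp
  next
    case False
    show ?thesis
    proof (cases "p = q")
      case True
      then show ?thesis using nn by simp
    next
      case ne: False
      have "torus_dist p q powr \<alpha> > 0" using False torus_dist_nonneg[of p q] by simp
      then have "\<bar>\<phi> p - \<phi> q\<bar> \<le> holder_seminorm \<alpha> \<phi> * torus_dist p q powr \<alpha>"
        using semi[of "(p, q)"] ne pq by (simp add: divide_le_eq)
      also have "\<dots> \<le> holder_norm \<alpha> \<phi> * torus_dist p q powr \<alpha>"
        using sup0 by (intro mult_right_mono) (auto simp: holder_norm_def)
      finally show ?thesis .
    qed
  qed
  have hol: "\<bar>periodic_ext \<phi> p - periodic_ext \<phi> q\<bar> \<le> holder_norm \<alpha> \<phi> * dist p q powr \<alpha>" for p q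
  proof -
    obtain x y x' y' where pq: "p = (x, y)" "q = (x', y')" by (cases p, cases q)
    have "\<bar>periodic_ext \<phi> p - periodic_ext \<phi> q\<bar> \<le>
        holder_norm \<alpha> \<phi> * torus_dist (frac x, frac y) (frac x', frac y') powr \<alpha>"
      unfolding pq periodic_ext_def using le2[OF frac_in frac_in] by simp
    also have "\<dots> \<le> holder_norm \<alpha> \<phi> * dist p q powr \<alpha>"
      unfolding pq using \<alpha> nn torus_dist_frac_le torus_dist_nonneg
      by (intro mult_left_mono powr_mono2) auto
    finally show ?thesis .
  qed
  have "continuous_on UNIV (periodic_ext \<phi>)"
  proof (rule continuous_on_eq_continuous_within[THEN iffD2], rule)
    fix p :: "real \<times> real"
    have "((\<lambda>q. holder_norm \<alpha> \<phi> * dist q p powr \<alpha>) \<longlongrightarrow> holder_norm \<alpha> \<phi> * 0) (at p)"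
    proof (intro tendsto_mult_left)
      have "((\<lambda>q. dist q p) \<longlongrightarrow> dist p p) (at p)" by (intro tendsto_intros)
      then show "((\<lambda>q. dist q p powr \<alpha>) \<longlongrightarrow> 0) (at p)"
        using tendsto_powr'[of "\<lambda>q. dist q p" 0 "at p" "\<lambda>_. \<alpha>" \<alpha>] \<alpha> by auto
    qed
    then have lim: "((\<lambda>q. holder_norm \<alpha> \<phi> * dist q p powr \<alpha>) \<longlongrightarrow> 0) (at p)" by simp
    have "((\<lambda>q. periodic_ext \<phi> q - periodic_ext \<phi> p) \<longlongrightarrow> 0) (at p)"
      by (rule Lim_null_comparison[OF _ lim], rule always_eventually, unfold real_norm_def, rule allI, rule hol)
    then show "continuous (at p) (periodic_ext \<phi>)"
      unfolding continuous_at by (rule LIM_zero_cancel)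
  qed
  moreover have "frac (z + 1) = frac z" for z :: real by (simp add: frac_def)
  ultimately have "torus_fun (periodic_ext \<phi>)" by (simp add: torus_fun_def periodic_ext_def)
  with hol show "torus_holder (holder_norm \<alpha> \<phi>) \<alpha> (periodic_ext \<phi>)"
    unfolding torus_holder_def using le1[OF frac_in] by (auto simp: periodic_ext_def)
qed

lemma pullback_bounded: "(\<And>p. \<bar>\<phi> p\<bar> \<le> N) \<Longrightarrow> \<bar>pullback f \<phi> m p\<bar> \<le> N"
  by (induction m arbitrary: p) (auto simp: case_prod_unfold)

text \<open>
  In the maximum norm, the inverse of a map with Lipschitz constant \<open>k i\<close> has Lipschitz constant
  \<open>k i + 1\<close>. The factor 2 compares the Euclidean with the maximum norm.
\<close>

lemma pullback_holder:
  assumes \<phi>: "torus_holder N \<alpha> \<phi>" and \<alpha>: "0 < \<alpha>" and k: "\<And>i. 0 \<le> k i"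
    and f: "\<And>i x y. 1 \<le> i \<Longrightarrow> \<bar>f i x - f i y\<bar> \<le> k i * \<bar>x - y\<bar>"
  shows "\<bar>pullback f \<phi> m (x, y) - pullback f \<phi> m (x', y')\<bar> \<le>
    N * (2 * (\<Prod>i=1..m. k i + 1) * max \<bar>x - x'\<bar> \<bar>y - y'\<bar>) powr \<alpha>"
proof (induction m arbitrary: x y x' y')
  case 0
  have N: "0 \<le> N" using \<phi> unfolding torus_holder_def by (meson abs_ge_zero order_trans)
  have "\<bar>\<phi> (x, y) - \<phi> (x', y')\<bar> \<le> N * dist (x, y) (x', y') powr \<alpha>"
    using \<phi> by (auto simp: torus_holder_def)
  also have "\<dots> \<le> N * (2 * max \<bar>x - x'\<bar> \<bar>y - y'\<bar>) powr \<alpha>"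
  proof (intro mult_left_mono powr_mono2)
    show "dist (x, y) (x', y') \<le> 2 * max \<bar>x - x'\<bar> \<bar>y - y'\<bar>"
      unfolding dist_Pair_Pair dist_real_def by (rule order_trans[OF sqrt_sum_squares_le_sum_abs]) (simp add: max_def)
  qed (use \<alpha> N in auto)
  finally show ?case by simp
next
  case (Suc m)
  have N: "0 \<le> N" using \<phi> unfolding torus_holder_def by (meson abs_ge_zero order_trans)
  let ?A = "\<Prod>i=1..m. k i + 1"
  have A: "0 \<le> ?A" using k by (intro prod_nonneg) (simp add: add_nonneg_nonneg)
  let ?M = "max \<bar>x - x'\<bar> \<bar>y - y'\<bar>"
  have "\<bar>pullback f \<phi> (Suc m) (x, y) - pullback f \<phi> (Suc m) (x', y')\<bar> \<le>
      N * (2 * ?A * max \<bar>y - y'\<bar> \<bar>f (Suc m) y - x - (f (Suc m) y' - x')\<bar>) powr \<alpha>"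
    using Suc[of y "f (Suc m) y - x" y' "f (Suc m) y' - x'"] by simp
  also have "\<dots> \<le> N * (2 * ?A * ((k (Suc m) + 1) * ?M)) powr \<alpha>"
  proof (intro mult_left_mono powr_mono2)
    have "k (Suc m) * \<bar>y - y'\<bar> \<le> k (Suc m) * ?M" using k by (intro mult_left_mono) auto
    moreover have "0 \<le> k (Suc m) * ?M" using k by auto
    ultimately show "max \<bar>y - y'\<bar> \<bar>f (Suc m) y - x - (f (Suc m) y' - x')\<bar> \<le> (k (Suc m) + 1) * ?M"
      using f[of "Suc m" y y'] by (simp add: algebra_simps) linarith
  qed (use \<alpha> N A in auto)
  also have "2 * ?A * ((k (Suc m) + 1) * ?M) = 2 * (\<Prod>i=1..Suc m. k i + 1) * ?M"
    by (simp add: mult.commute mult.left_commute)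
  finally show ?case .
qed

section \<open>A cutoff function\<close>

definition pos_sq :: "real \<Rightarrow> real" where
  "pos_sq t = (max 0 t)\<^sup>2"

lemma pos_sq_has_derivative: "(pos_sq has_real_derivative 2 * max 0 t) (at t)"
proof -
  consider "t > 0" | "t < 0" | "t = 0" by linarith
  then show ?thesis
  proof cases
    case 1
    have "((\<lambda>t. t\<^sup>2) has_real_derivative 2 * max 0 t) (at t)"
      using 1 by (auto intro!: derivative_eq_intros)
    then show ?thesis
      by (rule has_field_derivative_transform_within_open[of _ _ _ "{0<..}"])
        (use 1 in \<open>auto simp: pos_sq_def\<close>)
  next
    case 2
    have "((\<lambda>t. 0) has_real_derivative 2 * max 0 t) (at t)"
      using 2 by (auto intro!: derivative_eq_intros)
    then show ?thesis
      by (rule has_field_derivative_transform_within_open[of _ _ _ "{..<0}"])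
        (use 2 in \<open>auto simp: pos_sq_def\<close>)
  next
    case 3
    have "((\<lambda>h. pos_sq h / h) \<longlongrightarrow> 0) (at 0)"
    proof (rule Lim_null_comparison)
      show "\<forall>\<^sub>F h in at 0. norm (pos_sq h / h) \<le> \<bar>h\<bar>"
        by (rule always_eventually) (auto simp: pos_sq_def power2_eq_square max_def)
      show "((\<lambda>h::real. \<bar>h\<bar>) \<longlongrightarrow> 0) (at 0)"
        using tendsto_rabs[OF tendsto_ident_at, of "0::real" UNIV] by simp
    qed
    then show ?thesis using 3 by (simp add: DERIV_def pos_sq_def)
  qed
qed

text \<open>
  A continuously differentiable step from 0 (for \<open>t \<le> 0\<close>) to 1 (for \<open>t \<ge> 1\<close>), built from two truncated
  squares.
\<close>

definition bump :: "real \<Rightarrow> real" where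
  "bump t = 1 - pos_sq (1 - pos_sq t)"

definition dbump :: "real \<Rightarrow> real" where
  "dbump t = 2 * max 0 (1 - pos_sq t) * (2 * max 0 t)"

lemma bump_has_derivative: "(bump has_real_derivative dbump t) (at t)"
proof -
  have "((\<lambda>t. pos_sq (1 - pos_sq t)) has_real_derivative 2 * max 0 (1 - pos_sq t) * - (2 * max 0 t)) (at t)"
    by (rule DERIV_chain2[OF pos_sq_has_derivative])
      (auto intro!: derivative_eq_intros pos_sq_has_derivative)
  then have "((\<lambda>t. 1 - pos_sq (1 - pos_sq t)) has_real_derivative
      0 - 2 * max 0 (1 - pos_sq t) * - (2 * max 0 t)) (at t)"
    by (intro DERIV_diff DERIV_const)
  moreover have "bump = (\<lambda>t. 1 - pos_sq (1 - pos_sq t))" by (simp add: bump_def fun_eq_iff)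
  ultimately show ?thesis by (simp add: dbump_def)
qed

lemma pos_sq_unit: "t \<le> 1 \<Longrightarrow> 0 \<le> pos_sq t \<and> pos_sq t \<le> 1"
  by (auto simp: pos_sq_def power_le_one)

lemma bump_range: "0 \<le> bump t" "bump t \<le> 1"
  using pos_sq_unit[of "1 - pos_sq t"] by (auto simp: bump_def pos_sq_def)

lemma bump_low: "t \<le> 0 \<Longrightarrow> bump t = 0" "t \<le> 0 \<Longrightarrow> dbump t = 0"
  by (auto simp: bump_def dbump_def pos_sq_def)

lemma bump_high: "1 \<le> t \<Longrightarrow> bump t = 1" "1 \<le> t \<Longrightarrow> dbump t = 0"
  using one_le_power[of t 2] by (auto simp: bump_def dbump_def pos_sq_def)

lemma dbump_bound: "\<bar>dbump t\<bar> \<le> 4"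
proof (cases "t \<le> 0 \<or> 1 \<le> t")
  case True
  then show ?thesis using bump_low bump_high by auto
next
  case False
  have "\<bar>dbump t\<bar> = (2 * max 0 (1 - pos_sq t)) * (2 * max 0 t)"
    by (simp add: dbump_def abs_mult)
  also have "\<dots> \<le> 2 * 2" using False by (intro mult_mono) (auto simp: pos_sq_def)
  finally show ?thesis by simp
qed

section \<open>Expansion, curvature and cutoffs along horizontal lines\<close>

text \<open>
  The first and the second derivative of \<open>orb g x y j\<close> with respect to \<open>x\<close>.
\<close>

fun dorb :: "(nat \<Rightarrow> real \<Rightarrow> real) \<Rightarrow> real \<Rightarrow> real \<Rightarrow> nat \<Rightarrow> real" where
  "dorb g x y 0 = 0"
| "dorb g x y (Suc 0) = 1"
| "dorb g x y (Suc (Suc j)) =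
     deriv (g (Suc j)) (orb g x y (Suc j)) * dorb g x y (Suc j) - dorb g x y j"

fun ddorb :: "(nat \<Rightarrow> real \<Rightarrow> real) \<Rightarrow> real \<Rightarrow> real \<Rightarrow> nat \<Rightarrow> real" where
  "ddorb g x y 0 = 0"
| "ddorb g x y (Suc 0) = 0"
| "ddorb g x y (Suc (Suc j)) =
     deriv (deriv (g (Suc j))) (orb g x y (Suc j)) * (dorb g x y (Suc j))\<^sup>2
     + deriv (g (Suc j)) (orb g x y (Suc j)) * ddorb g x y (Suc j) - ddorb g x y j"

text \<open>
  For a map of strength \<open>l\<close>, the parameters stand for \<open>s = l powr \<eta>\<close> and \<open>\<sigma> = l powr (1 - 2 * \<eta>)\<close>, so
  \<open>second_deriv\<close> says that the second derivative is at most \<open>\<kappa> * l\<close>. A derivative of size at least \<open>s\<close>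
  counts as expansion, and \<open>\<sigma>\<close> is the order of all distortion terms. The constants in \<open>small\<close>
  are large enough for the recursive estimates of curvature and cutoffs below to reproduce
  themselves.
\<close>

locale expanding_system =
  fixes g :: "nat \<Rightarrow> real \<Rightarrow> real" and s \<sigma> :: "nat \<Rightarrow> real" and \<kappa> :: real
  assumes periodic: "\<And>j x. g (Suc j) (x + 1) = g (Suc j) x"
    and diff1: "\<And>j z. (g (Suc j) has_real_derivative deriv (g (Suc j)) z) (at z)"
    and diff2: "\<And>j z. (deriv (g (Suc j)) has_real_derivative deriv (deriv (g (Suc j))) z) (at z)"
    and second_deriv: "\<And>j z. \<bar>deriv (deriv (g (Suc j))) z\<bar> \<le> \<kappa> * \<sigma> (Suc j) * (s (Suc j))\<^sup>2"
    and kappa: "0 \<le> \<kappa>"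
    and s_pos: "\<And>j. 0 < s (Suc j)"
    and inv_s: "\<And>j. 1 / s (Suc j) \<le> \<sigma> (Suc j)"
    and small: "\<And>j. (32 * \<kappa> + 16) * \<sigma> (Suc j) \<le> 1"
begin

lemma sigma_pos: "0 < \<sigma> (Suc j)"
  using inv_s[of j] s_pos[of j] by (smt (verit) divide_pos_pos)

lemma s_large: "16 \<le> s (Suc j)"
proof -
  have "16 * \<sigma> (Suc j) \<le> (32 * \<kappa> + 16) * \<sigma> (Suc j)"
    using kappa sigma_pos[of j] by (intro mult_right_mono) auto
  then have "16 * (1 / s (Suc j)) \<le> 1" using small[of j] inv_s[of j] by linarith
  then show ?thesis using s_pos[of j] by (simp add: field_simps)
qed

lemma sigma_s: "1 \<le> \<sigma> (Suc j) * s (Suc j)"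
  using inv_s[of j] s_pos[of j] by (simp add: field_simps)

lemma circle_g: "circle_fun (g (Suc j))"
  unfolding circle_fun_def
  using DERIV_continuous_on[OF has_field_derivative_at_within[OF diff1]] periodic by blast

lemma circle_dg: "circle_fun (deriv (g (Suc j)))"
  unfolding circle_fun_def
proof (intro conjI allI)
  show "continuous_on UNIV (deriv (g (Suc j)))"
    by (rule DERIV_continuous_on[OF has_field_derivative_at_within[OF diff2]])
  fix x
  have "((\<lambda>z. g (Suc j) (z + 1)) has_real_derivative deriv (g (Suc j)) (x + 1)) (at x)"
    using diff1[of j "x + 1"] DERIV_shift[of "g (Suc j)" _ x 1] by blast
  then have "(g (Suc j) has_real_derivative deriv (g (Suc j)) (x + 1)) (at x)"
    by (simp add: periodic)
  then show "deriv (g (Suc j)) (x + 1) = deriv (g (Suc j)) x"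
    by (metis DERIV_imp_deriv)
qed

lemma orb_has_derivative: "((\<lambda>x. orb g x y j) has_real_derivative dorb g x y j) (at x)"
proof -
  have "((\<lambda>x. orb g x y j) has_real_derivative dorb g x y j) (at x) \<and>
    ((\<lambda>x. orb g x y (Suc j)) has_real_derivative dorb g x y (Suc j)) (at x)"
    by (induction j) (auto intro!: derivative_eq_intros DERIV_chain2[OF diff1])
  then show ?thesis ..
qed

lemma dorb_has_derivative: "((\<lambda>x. dorb g x y j) has_real_derivative ddorb g x y j) (at x)"
proof -
  have "((\<lambda>x. dorb g x y j) has_real_derivative ddorb g x y j) (at x) \<and>
    ((\<lambda>x. dorb g x y (Suc j)) has_real_derivative ddorb g x y (Suc j)) (at x)"
  proof (induction j)
    case (Suc j)
    have "((\<lambda>x. deriv (g (Suc j)) (orb g x y (Suc j))) has_real_derivative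
        deriv (deriv (g (Suc j))) (orb g x y (Suc j)) * dorb g x y (Suc j)) (at x)"
      by (rule DERIV_chain2[OF diff2 orb_has_derivative])
    from DERIV_diff[OF DERIV_mult[OF this] , of "\<lambda>x. dorb g x y (Suc j)" "ddorb g x y (Suc j)"
        "\<lambda>x. dorb g x y j" "ddorb g x y j"]
    show ?case using Suc by (simp add: power2_eq_square algebra_simps)
  qed auto
  then show ?thesis ..
qed

definition hyperbolic :: "nat \<Rightarrow> real \<Rightarrow> real \<Rightarrow> bool" where
  "hyperbolic K x y \<longleftrightarrow> (\<forall>j<K. s (Suc j) \<le> \<bar>deriv (g (Suc j)) (orb g x y (Suc j))\<bar>)"

text \<open>
  In the recursion for the derivative, the subtracted term is at most the previous derivative, which
  is itself multiplied by at least \<open>s \<ge> 16\<close>; so it can cost at most half of the growth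
  (\<open>dorb_step\<close>).
\<close>

lemma dorb_growth:
  assumes "hyperbolic K x y" "i \<le> K"
  shows "\<bar>dorb g x y i\<bar> \<le> \<bar>dorb g x y (Suc i)\<bar>" and "dorb g x y (Suc i) \<noteq> 0"
proof -
  have "\<bar>dorb g x y i\<bar> \<le> \<bar>dorb g x y (Suc i)\<bar> \<and> dorb g x y (Suc i) \<noteq> 0" using assms(2)
  proof (induction i)
    case (Suc i)
    let ?G = "deriv (g (Suc i)) (orb g x y (Suc i))"
    let ?d = "\<bar>dorb g x y (Suc i)\<bar>"
    have "s (Suc i) \<le> \<bar>?G\<bar>" using assms(1) Suc.prems by (simp add: hyperbolic_def)
    then have G: "2 \<le> \<bar>?G\<bar>" using s_large[of i] by linarith
    have d: "\<bar>dorb g x y i\<bar> \<le> ?d" "0 < ?d" using Suc by auto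
    have "2 * ?d \<le> \<bar>?G\<bar> * ?d" using G by (intro mult_right_mono) auto
    also have "\<dots> = \<bar>?G * dorb g x y (Suc i)\<bar>" by (simp add: abs_mult)
    also have "\<dots> \<le> \<bar>dorb g x y (Suc (Suc i))\<bar> + ?d" using d by simp
    finally show ?case using d by auto
  qed simp
  then show "\<bar>dorb g x y i\<bar> \<le> \<bar>dorb g x y (Suc i)\<bar>" "dorb g x y (Suc i) \<noteq> 0" by auto
qed

lemma dorb_step:
  assumes "hyperbolic K x y" "i < K"
  shows "\<bar>deriv (g (Suc i)) (orb g x y (Suc i))\<bar> * \<bar>dorb g x y (Suc i)\<bar> \<le> 2 * \<bar>dorb g x y (Suc (Suc i))\<bar>"
    and "s (Suc i) * \<bar>dorb g x y (Suc i)\<bar> \<le> 2 * \<bar>dorb g x y (Suc (Suc i))\<bar>"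
proof -
  let ?G = "deriv (g (Suc i)) (orb g x y (Suc i))"
  let ?d = "\<bar>dorb g x y (Suc i)\<bar>"
  have G: "s (Suc i) \<le> \<bar>?G\<bar>" "2 \<le> \<bar>?G\<bar>" using assms s_large[of i] by (force simp: hyperbolic_def)+
  have d: "\<bar>dorb g x y i\<bar> \<le> ?d" using dorb_growth(1)[OF assms(1), of i] assms(2) by simp
  have "2 * ?d \<le> \<bar>?G\<bar> * ?d" using G by (intro mult_right_mono) auto
  moreover have "\<bar>?G\<bar> * ?d = \<bar>?G * dorb g x y (Suc i)\<bar>" by (simp add: abs_mult)
  moreover have "\<bar>?G * dorb g x y (Suc i)\<bar> \<le> \<bar>dorb g x y (Suc (Suc i))\<bar> + ?d" using d by simp
  ultimately show 1: "\<bar>?G\<bar> * ?d \<le> 2 * \<bar>dorb g x y (Suc (Suc i))\<bar>" by linarith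
  have "s (Suc i) * ?d \<le> \<bar>?G\<bar> * ?d" using G by (intro mult_right_mono) auto
  then show "s (Suc i) * ?d \<le> 2 * \<bar>dorb g x y (Suc (Suc i))\<bar>" using 1 by linarith
qed

lemma dorb_lower:
  assumes "hyperbolic K x y" "i \<le> K"
  shows "1 \<le> \<bar>dorb g x y (Suc i)\<bar> * (\<Prod>j<i. 2 / s (Suc j))"
  using assms(2)
proof (induction i)
  case (Suc i)
  have P: "0 \<le> (\<Prod>j<i. 2 / s (Suc j))" using s_pos by (intro prod_nonneg) (auto intro: less_imp_le)
  have "\<bar>dorb g x y (Suc i)\<bar> \<le> \<bar>dorb g x y (Suc (Suc i))\<bar> * (2 / s (Suc i))"
    using dorb_step(2)[OF assms(1), of i] Suc.prems s_pos[of i] by (simp add: field_simps)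
  from mult_right_mono[OF this P] show ?case using Suc by (simp add: algebra_simps)
qed simp

text \<open>
  Dividing the recursion for the second derivative by the square of the new first derivative leaves
  a new contribution of order \<open>\<kappa> * \<sigma>\<close>, and the previous curvatures divided by at least \<open>s\<close>, where
  \<open>1 / s \<le> \<sigma>\<close>. It therefore suffices to know that the previous curvatures are at most 1: no
  summation over the past is needed, and the bound depends on the last map only.
\<close>

lemma ddorb_bound:
  assumes "hyperbolic K x y" "i < K"
  shows "\<bar>ddorb g x y (Suc (Suc i))\<bar> \<le> (4 * \<kappa> + 8) * \<sigma> (Suc i) * (dorb g x y (Suc (Suc i)))\<^sup>2"
proof -
  have step: "\<bar>ddorb g x y (Suc (Suc i))\<bar> \<le> (4 * \<kappa> + 8) * \<sigma> (Suc i) * (dorb g x y (Suc (Suc i)))\<^sup>2"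
    if i: "i < K" and IH: "\<bar>ddorb g x y i\<bar> \<le> (dorb g x y i)\<^sup>2" "\<bar>ddorb g x y (Suc i)\<bar> \<le> (dorb g x y (Suc i))\<^sup>2"
    for i
  proof -
    let ?G = "deriv (g (Suc i)) (orb g x y (Suc i))"
    let ?H = "deriv (deriv (g (Suc i))) (orb g x y (Suc i))"
    define G where "G = \<bar>?G\<bar>"
    define d where "d = \<bar>dorb g x y (Suc i)\<bar>"
    define e where "e = \<bar>dorb g x y (Suc (Suc i))\<bar>"
    define S where "S = s (Suc i)"
    define T where "T = \<sigma> (Suc i)"
    have S: "16 \<le> S" and T: "0 < T" and TS: "1 \<le> T * S"
      using s_large[of i] sigma_pos[of i] sigma_s[of i] by (auto simp: S_def T_def)
    have G: "S \<le> G" using assms(1) i by (auto simp: hyperbolic_def S_def G_def)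
    have Gd: "G * d \<le> 2 * e" using dorb_step(1)[OF assms(1) i] by (simp add: G_def d_def e_def)
    have nn: "0 \<le> d" "0 \<le> e" by (auto simp: d_def e_def)
    have sq: "(G * d)\<^sup>2 \<le> 4 * e\<^sup>2"
      using power_mono[OF Gd, of 2] nn S G by (simp add: power_mult_distrib)
    have a: "S\<^sup>2 * d\<^sup>2 \<le> 4 * e\<^sup>2"
    proof -
      have "S\<^sup>2 * d\<^sup>2 \<le> G\<^sup>2 * d\<^sup>2" using G S by (intro mult_right_mono power_mono) auto
      then show ?thesis using sq by (simp add: power_mult_distrib)
    qed
    have b: "G * d\<^sup>2 \<le> 4 * T * e\<^sup>2"
    proof -
      have "G * d\<^sup>2 * 1 \<le> G * d\<^sup>2 * (T * G)"
      proof (rule mult_left_mono)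
        show "1 \<le> T * G" using TS T mult_left_mono[OF G, of T] by linarith
      qed (use G S in auto)
      also have "\<dots> = T * (G * d)\<^sup>2" by (simp add: power2_eq_square)
      also have "\<dots> \<le> T * (4 * e\<^sup>2)" using sq T by (intro mult_left_mono) auto
      finally show ?thesis by simp
    qed
    have c: "d\<^sup>2 \<le> 4 * T * e\<^sup>2"
    proof -
      have "1 * d\<^sup>2 \<le> G * d\<^sup>2" using S G by (intro mult_right_mono) auto
      then show ?thesis using b by simp
    qed
    have "\<bar>ddorb g x y (Suc (Suc i))\<bar> \<le> \<bar>?H\<bar> * d\<^sup>2 + G * \<bar>ddorb g x y (Suc i)\<bar> + \<bar>ddorb g x y i\<bar>"
    proof -
      have "\<bar>a + b - c\<bar> \<le> \<bar>a\<bar> + \<bar>b\<bar> + \<bar>c\<bar>" for a b c :: real by linarith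
      from this[of "?H * (dorb g x y (Suc i))\<^sup>2" "?G * ddorb g x y (Suc i)" "ddorb g x y i"]
      show ?thesis by (simp add: abs_mult d_def G_def)
    qed
    also have "\<bar>?H\<bar> * d\<^sup>2 \<le> \<kappa> * T * S\<^sup>2 * d\<^sup>2"
      using second_deriv[of i] by (intro mult_right_mono) (auto simp: T_def S_def)
    also have "\<dots> = \<kappa> * T * (S\<^sup>2 * d\<^sup>2)" by simp
    also have "\<dots> \<le> \<kappa> * T * (4 * e\<^sup>2)" using a kappa T by (intro mult_left_mono) auto
    also have "G * \<bar>ddorb g x y (Suc i)\<bar> \<le> G * d\<^sup>2"
      using IH(2) by (intro mult_left_mono) (auto simp: d_def G_def)
    also have "\<bar>ddorb g x y i\<bar> \<le> d\<^sup>2"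
    proof -
      have "\<bar>dorb g x y i\<bar> \<le> d" unfolding d_def using dorb_growth(1)[OF assms(1), of i] i by simp
      then have "(dorb g x y i)\<^sup>2 \<le> d\<^sup>2" using power_mono[of "\<bar>dorb g x y i\<bar>" d 2] by simp
      then show ?thesis using IH(1) by linarith
    qed
    finally have "\<bar>ddorb g x y (Suc (Suc i))\<bar> \<le> \<kappa> * T * (4 * e\<^sup>2) + 4 * T * e\<^sup>2 + 4 * T * e\<^sup>2"
      using b c by linarith
    then show ?thesis by (simp add: T_def e_def algebra_simps)
  qed
  \<comment> \<open>The crude bound by 1 that the step needs, and which the step preserves by smallness of \<open>\<sigma>\<close>.\<close>
  have crude: "i \<le> K \<Longrightarrow> \<bar>ddorb g x y i\<bar> \<le> (dorb g x y i)\<^sup>2 \<and> \<bar>ddorb g x y (Suc i)\<bar> \<le> (dorb g x y (Suc i))\<^sup>2" for i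
  proof (induction i)
    case (Suc i)
    then have "\<bar>ddorb g x y (Suc (Suc i))\<bar> \<le> ((4 * \<kappa> + 8) * \<sigma> (Suc i)) * (dorb g x y (Suc (Suc i)))\<^sup>2"
      using step[of i] by auto
    also have "\<dots> \<le> 1 * (dorb g x y (Suc (Suc i)))\<^sup>2"
    proof (rule mult_right_mono)
      have "(4 * \<kappa> + 8) * \<sigma> (Suc i) \<le> (32 * \<kappa> + 16) * \<sigma> (Suc i)"
        using kappa sigma_pos[of i] by (intro mult_right_mono) auto
      then show "(4 * \<kappa> + 8) * \<sigma> (Suc i) \<le> 1" using small[of i] by linarith
    qed simp
    finally show ?case using Suc by simp
  qed simp
  show ?thesis using step[OF assms(2)] crude[of i] assms(2) by simp
qed

text \<open>
  In absolute value, a derivative of at most \<open>s j\<close> is cut off, and one of at least \<open>3/2 * s j\<close> is kept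
  with full weight. Squaring avoids the corner of the absolute value.
\<close>

definition cut :: "nat \<Rightarrow> real \<Rightarrow> real" where
  "cut j z = bump ((deriv (g j) z / s j)\<^sup>2 - 1)"

definition dcut :: "nat \<Rightarrow> real \<Rightarrow> real" where
  "dcut j z = dbump ((deriv (g j) z / s j)\<^sup>2 - 1) *
     (2 * (deriv (g j) z / s j) * (deriv (deriv (g j)) z / s j))"

lemma cut_has_derivative: "(cut (Suc j) has_real_derivative dcut (Suc j) z) (at z)"
proof -
  have "((\<lambda>z. (deriv (g (Suc j)) z / s (Suc j))\<^sup>2 - 1) has_real_derivative
      (2 * (deriv (g (Suc j)) z / s (Suc j)) * (deriv (deriv (g (Suc j))) z / s (Suc j)))) (at z)"
    using s_pos[of j] by (auto intro!: derivative_eq_intros diff2)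
  from DERIV_chain2[OF bump_has_derivative this]
  show ?thesis by (simp add: cut_def[abs_def] dcut_def)
qed

lemma circle_cut: "circle_fun (cut (Suc j))"
proof -
  have "continuous_on UNIV (cut (Suc j))"
    by (rule DERIV_continuous_on[OF has_field_derivative_at_within[OF cut_has_derivative]])
  then show ?thesis using circle_dg[of j] by (simp add: circle_fun_def cut_def)
qed

lemma cut_range: "0 \<le> cut j z" "cut j z \<le> 1"
  by (simp_all add: cut_def bump_range)

lemma cut_low: "\<bar>deriv (g (Suc j)) z\<bar> \<le> s (Suc j) \<Longrightarrow> cut (Suc j) z = 0"
proof -
  assume "\<bar>deriv (g (Suc j)) z\<bar> \<le> s (Suc j)"
  then have "\<bar>deriv (g (Suc j)) z / s (Suc j)\<bar> \<le> 1" using s_pos[of j] by simp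
  then have "(deriv (g (Suc j)) z / s (Suc j))\<^sup>2 \<le> 1" by (simp add: abs_square_le_1)
  then show ?thesis by (simp add: cut_def bump_low)
qed

lemma cut_high: "3 / 2 * s (Suc j) \<le> \<bar>deriv (g (Suc j)) z\<bar> \<Longrightarrow> cut (Suc j) z = 1"
proof -
  assume "3 / 2 * s (Suc j) \<le> \<bar>deriv (g (Suc j)) z\<bar>"
  then have r: "3 / 2 \<le> \<bar>deriv (g (Suc j)) z / s (Suc j)\<bar>" using s_pos[of j] by (simp add: field_simps)
  have "(3 / 2 :: real)\<^sup>2 \<le> (deriv (g (Suc j)) z / s (Suc j))\<^sup>2"
    using power_mono[OF r, of 2] by (simp only: power2_abs)
  moreover have "(2::real) \<le> (3 / 2)\<^sup>2" by (simp add: power2_eq_square)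
  ultimately have "1 \<le> (deriv (g (Suc j)) z / s (Suc j))\<^sup>2 - 1" by linarith
  then show ?thesis by (simp add: cut_def bump_high)
qed

text \<open>
  On the transition region the derivative of the map is comparable to \<open>s\<close>, so only one factor \<open>s\<close> of
  the bound for the second derivative survives.
\<close>

lemma dcut_bound: "\<bar>dcut (Suc j) z\<bar> \<le> 12 * \<kappa> * \<sigma> (Suc j) * s (Suc j)"
proof -
  define r where "r = deriv (g (Suc j)) z / s (Suc j)"
  define q where "q = deriv (deriv (g (Suc j))) z / s (Suc j)"
  have q: "\<bar>q\<bar> \<le> \<kappa> * \<sigma> (Suc j) * s (Suc j)"
    using second_deriv[of j z] s_pos[of j] by (simp add: q_def divide_le_eq power2_eq_square)
  have eq: "\<bar>dcut (Suc j) z\<bar> = \<bar>dbump (r\<^sup>2 - 1)\<bar> * (2 * \<bar>r\<bar> * \<bar>q\<bar>)"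
    by (simp add: dcut_def r_def q_def abs_mult)
  show ?thesis
  proof (cases "\<bar>r\<bar> \<le> 3 / 2")
    case True
    have "\<bar>dbump (r\<^sup>2 - 1)\<bar> * (2 * \<bar>r\<bar> * \<bar>q\<bar>) \<le> 4 * (2 * (3 / 2) * (\<kappa> * \<sigma> (Suc j) * s (Suc j)))"
      using True q by (intro mult_mono dbump_bound) auto
    then show ?thesis using eq by simp
  next
    case False
    then have "1 \<le> r\<^sup>2 - 1" using power_mono[of "3/2" "\<bar>r\<bar>" 2] by (simp add: power2_eq_square)
    then have "dcut (Suc j) z = 0" using eq bump_high(2) by simp
    then show ?thesis using kappa sigma_pos[of j] s_pos[of j] by simp
  qed
qed

text \<open>
  The cutoff to orbits along which the first \<open>K\<close> maps expand, and its derivative in \<open>x\<close>.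
\<close>

fun chi :: "nat \<Rightarrow> real \<Rightarrow> real \<Rightarrow> real" where
  "chi 0 x y = 1"
| "chi (Suc K) x y = chi K x y * cut (Suc K) (orb g x y (Suc K))"

fun dchi :: "nat \<Rightarrow> real \<Rightarrow> real \<Rightarrow> real" where
  "dchi 0 x y = 0"
| "dchi (Suc K) x y = dchi K x y * cut (Suc K) (orb g x y (Suc K))
     + dcut (Suc K) (orb g x y (Suc K)) * dorb g x y (Suc K) * chi K x y"

lemma chi_has_derivative: "((\<lambda>x. chi K x y) has_real_derivative dchi K x y) (at x)"
proof (induction K)
  case (Suc K)
  have "((\<lambda>x. cut (Suc K) (orb g x y (Suc K))) has_real_derivative
      dcut (Suc K) (orb g x y (Suc K)) * dorb g x y (Suc K)) (at x)"
    by (rule DERIV_chain2[OF cut_has_derivative orb_has_derivative])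
  from DERIV_mult[OF Suc this] show ?case by simp
qed simp

lemma chi_range: "0 \<le> chi K x y \<and> chi K x y \<le> 1"
  by (induction K) (auto intro!: mult_nonneg_nonneg mult_le_one cut_range)

lemma chi_defect: "1 - chi K x y \<le> (\<Sum>j<K. 1 - cut (Suc j) (orb g x y (Suc j)))"
proof (induction K)
  case (Suc K)
  let ?c = "cut (Suc K) (orb g x y (Suc K))"
  have "1 - chi (Suc K) x y = (1 - chi K x y) + chi K x y * (1 - ?c)" by (simp add: algebra_simps)
  moreover have "chi K x y * (1 - ?c) \<le> 1 * (1 - ?c)"
    using chi_range[of K x y] cut_range by (intro mult_right_mono) auto
  ultimately show ?case using Suc by simp
qed simp

lemma chi_outside: "\<not> hyperbolic K x y \<Longrightarrow> chi K x y = 0"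
proof (induction K)
  case (Suc K)
  then show ?case using cut_low[of K "orb g x y (Suc K)"] by (auto simp: hyperbolic_def less_Suc_eq)
qed (simp add: hyperbolic_def)

lemma torus_fun_chi: "torus_fun (\<lambda>(x, y). chi K x y)"
proof (induction K)
  case 0
  then show ?case by (simp add: torus_fun_def)
next
  case (Suc K)
  have "torus_fun (\<lambda>(x, y). cut (Suc K) (orb g x y (Suc K)))"
    using torus_fun_orb[of g, OF circle_g torus_fun_of_circle_fun(2)[OF circle_cut[of K]], of "Suc K"] by simp
  with Suc show ?case unfolding torus_fun_def
    by (auto simp: case_prod_unfold intro!: continuous_intros)
qed

text \<open>
  The same mechanism as for the curvature: the derivatives of the earlier cutoffs are at most the
  previous derivative of the orbit, which the last expansion makes negligible.
\<close>

lemma dchi_bound: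
  assumes "hyperbolic (Suc K) x y"
  shows "\<bar>dchi (Suc K) x y\<bar> \<le> (2 + 24 * \<kappa>) * \<sigma> (Suc K) * \<bar>dorb g x y (Suc (Suc K))\<bar>"
proof -
  have step: "\<bar>dchi (Suc i) x y\<bar> \<le> (2 + 24 * \<kappa>) * \<sigma> (Suc i) * \<bar>dorb g x y (Suc (Suc i))\<bar>"
    if i: "i \<le> K" and IH: "\<bar>dchi i x y\<bar> \<le> \<bar>dorb g x y (Suc i)\<bar>" for i
  proof -
    define d where "d = \<bar>dorb g x y (Suc i)\<bar>"
    define e where "e = \<bar>dorb g x y (Suc (Suc i))\<bar>"
    define S where "S = s (Suc i)"
    define T where "T = \<sigma> (Suc i)"
    have S: "16 \<le> S" and T: "0 < T" and TS: "1 \<le> T * S"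
      using s_large[of i] sigma_pos[of i] sigma_s[of i] by (auto simp: S_def T_def)
    have nn: "0 \<le> d" "0 \<le> e" by (auto simp: d_def e_def)
    have Sd: "S * d \<le> 2 * e" using dorb_step(2)[OF assms, of i] i by (simp add: S_def d_def e_def)
    let ?z = "orb g x y (Suc i)"
    have "\<bar>dchi (Suc i) x y\<bar> \<le> \<bar>dchi i x y\<bar> * cut (Suc i) ?z + \<bar>dcut (Suc i) ?z\<bar> * d * chi i x y"
      using abs_triangle_ineq[of "dchi i x y * cut (Suc i) ?z" "dcut (Suc i) ?z * dorb g x y (Suc i) * chi i x y"]
        chi_range[of i x y] cut_range[of "Suc i" ?z] by (simp add: abs_mult d_def)
    also have "\<dots> \<le> d * 1 + (12 * \<kappa> * T * S) * d * 1"
      using IH dcut_bound[of i ?z] chi_range[of i x y] cut_range[of "Suc i" ?z] kappa T S nn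
      by (intro add_mono mult_mono) (auto simp: d_def T_def S_def)
    also have "\<dots> \<le> (T * S) * d + (12 * \<kappa> * T * S) * d"
      using mult_right_mono[OF TS nn(1)] by simp
    also have "\<dots> = (T + 12 * \<kappa> * T) * (S * d)" by (simp add: algebra_simps)
    also have "\<dots> \<le> (T + 12 * \<kappa> * T) * (2 * e)" using Sd T kappa by (intro mult_left_mono) auto
    finally show ?thesis by (simp add: T_def e_def algebra_simps)
  qed
  have crude: "i \<le> Suc K \<Longrightarrow> \<bar>dchi i x y\<bar> \<le> \<bar>dorb g x y (Suc i)\<bar>" for i
  proof (induction i)
    case (Suc i)
    then have "\<bar>dchi (Suc i) x y\<bar> \<le> ((2 + 24 * \<kappa>) * \<sigma> (Suc i)) * \<bar>dorb g x y (Suc (Suc i))\<bar>"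
      using step[of i] by simp
    also have "\<dots> \<le> 1 * \<bar>dorb g x y (Suc (Suc i))\<bar>"
    proof (rule mult_right_mono)
      have "(2 + 24 * \<kappa>) * \<sigma> (Suc i) \<le> (32 * \<kappa> + 16) * \<sigma> (Suc i)"
        using kappa sigma_pos[of i] by (intro mult_right_mono) auto
      then show "(2 + 24 * \<kappa>) * \<sigma> (Suc i) \<le> 1" using small[of i] by linarith
    qed simp
    finally show ?case by simp
  qed simp
  show ?thesis using step[of K] crude[of K] by simp
qed

end

section \<open>Potentials\<close>

lemma continuous_moving_avg:
  fixes F :: "real \<Rightarrow> real \<Rightarrow> real"
  assumes F: "continuous_on UNIV (\<lambda>(u, v). F u v)" and "continuous_on S a" "continuous_on S b"
  shows "continuous_on S (\<lambda>p. moving_avg d (F (a p)) (b p))"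
proof -
  have "continuous_on UNIV (\<lambda>q. F (fst (fst q)) (snd (fst q) + snd q))"
    using continuous_compose_pair[OF F, of UNIV "\<lambda>q. fst (fst q)" "\<lambda>q. snd (fst q) + snd q"]
    by (simp add: continuous_intros)
  then have "continuous_on UNIV (\<lambda>p. integral {0..d} (\<lambda>t. F (fst p) (snd p + t)) * (1 / d))"
    by (intro continuous_on_mult_right
        continuous_integral_param[where F = "\<lambda>p t. F (fst p) (snd p + t)"])
  from continuous_compose_pair[OF this assms(2,3)] show ?thesis
    by (simp add: moving_avg_def)
qed

definition fibre_mean :: "(real \<times> real \<Rightarrow> real) \<Rightarrow> real \<Rightarrow> real" where
  "fibre_mean \<psi> v = integral {0..1} (\<lambda>u. \<psi> (u, v))"

lemma circle_fun_fibre_mean: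
  assumes "torus_fun \<psi>"
  shows "circle_fun (fibre_mean \<psi>)"
proof -
  have "continuous_on UNIV (\<lambda>v. integral (cbox 0 1) (\<lambda>u. \<psi> (u, v)))"
    unfolding case_prod_unfold
    by (rule integral_continuous_on_param, unfold case_prod_unfold)
      (intro torus_fun_cont[OF assms] continuous_intros)
  then show ?thesis using assms by (auto simp: circle_fun_def fibre_mean_def[abs_def] torus_fun_def)
qed

lemma integral_unit_close:
  fixes f :: "real \<Rightarrow> real"
  assumes f: "continuous_on UNIV f" and b: "\<And>t. \<bar>f t - c\<bar> \<le> B"
  shows "\<bar>integral {0..1} f - c\<bar> \<le> B"
proof -
  have "(f has_integral integral {0..1} f) {0..1}"
    using continuous_on_subset[OF f] by (intro integrable_integral integrable_continuous_real) auto
  from has_integral_diff[OF this has_integral_const_real[of c 0 1]]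
  have "((\<lambda>t. f t - c) has_integral (integral {0..1} f - c)) {0..1}" by simp
  moreover have "0 \<le> B" using b[of 0] by linarith
  ultimately have "norm (integral {0..1} f - c) \<le> B * measure lborel (cbox 0 (1::real))"
    using b by (intro has_integral_bound) auto
  then show ?thesis by simp
qed

lemma fibre_mean_bound:
  assumes "torus_fun \<psi>" and b: "\<And>p. \<bar>\<psi> p\<bar> \<le> N"
  shows "\<bar>fibre_mean \<psi> v\<bar> \<le> N"
proof -
  have "continuous_on UNIV (\<lambda>u. \<psi> (u, v))"
    by (intro torus_fun_cont[OF assms(1)] continuous_intros)
  from integral_unit_close[OF this, of 0 N] b show ?thesis by (simp add: fibre_mean_def)
qed

lemma fibre_mean_holder:
  assumes \<psi>: "torus_holder N \<alpha> \<psi>"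
  shows "\<bar>fibre_mean \<psi> v - fibre_mean \<psi> w\<bar> \<le> N * \<bar>v - w\<bar> powr \<alpha>"
proof -
  have t: "torus_fun \<psi>" using \<psi> by (simp add: torus_holder_def)
  have c: "continuous_on UNIV (\<lambda>u. \<psi> (u, v))" for v
    by (intro torus_fun_cont[OF t] continuous_intros)
  have "integral {0..1} (\<lambda>u. \<psi> (u, v) - \<psi> (u, w)) = fibre_mean \<psi> v - fibre_mean \<psi> w"
    unfolding fibre_mean_def using c
    by (intro Henstock_Kurzweil_Integration.integral_diff integrable_continuous_real) (auto intro: continuous_on_subset)
  moreover have "\<bar>integral {0..1} (\<lambda>u. \<psi> (u, v) - \<psi> (u, w)) - 0\<bar> \<le> N * \<bar>v - w\<bar> powr \<alpha>"
  proof (rule integral_unit_close)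
    show "continuous_on UNIV (\<lambda>u. \<psi> (u, v) - \<psi> (u, w))" by (intro continuous_intros c)
    fix u
    have "\<bar>\<psi> (u, v) - \<psi> (u, w)\<bar> \<le> N * dist (u, v) (u, w) powr \<alpha>"
      using \<psi> by (auto simp: torus_holder_def)
    then show "\<bar>\<psi> (u, v) - \<psi> (u, w) - 0\<bar> \<le> N * \<bar>v - w\<bar> powr \<alpha>"
      by (simp add: dist_Pair_Pair dist_real_def)
  qed
  ultimately show ?thesis by simp
qed

text \<open>
  The chain rule for a function of two variables given by its partial derivatives. Continuity of one
  of them is enough for differentiability.
\<close>

lemma has_derivative_of_partials:
  fixes F Fu Fv :: "real \<Rightarrow> real \<Rightarrow> real"
  assumes du: "\<And>u v. ((\<lambda>u. F u v) has_real_derivative Fu u v) (at u)"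
    and dv: "\<And>u v. (F u has_real_derivative Fv u v) (at v)"
    and cv: "continuous_on UNIV (\<lambda>(u, v). Fv u v)"
    and X: "(X has_real_derivative X') (at t)" and Y: "(Y has_real_derivative Y') (at t)"
  shows "((\<lambda>t. F (X t) (Y t)) has_real_derivative Fu (X t) (Y t) * X' + Fv (X t) (Y t) * Y') (at t)"
proof -
  have "((\<lambda>(u, v). F u v) has_derivative (\<lambda>(h, k). Fu u v * h + blinfun_mult_right (Fv u v) k)) (at (u, v) within UNIV \<times> UNIV)"
    for u v
  proof (rule has_derivative_partialsI)
    show "((\<lambda>u. F u v) has_derivative (\<lambda>h. Fu u v * h)) (at u)"
      using du[of v u] by (simp add: has_field_derivative_def)
    show "(F x has_derivative blinfun_apply (blinfun_mult_right (Fv x y))) (at y)" for x y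
      using dv[of x y] by (simp add: has_field_derivative_def)
    have "continuous_on UNIV (\<lambda>p. blinfun_mult_right ((\<lambda>(u, v). Fv u v) p))"
      by (rule bounded_linear.continuous_on[OF bounded_linear_blinfun_mult_right cv])
    then show "continuous (at (u, v) within UNIV \<times> UNIV) (\<lambda>(x, y). blinfun_mult_right (Fv x y))"
      by (simp add: continuous_on_eq_continuous_within case_prod_unfold)
  qed auto
  then have F: "((\<lambda>(u, v). F u v) has_derivative (\<lambda>(h, k). Fu (X t) (Y t) * h + Fv (X t) (Y t) * k)) (at (X t, Y t))"
    by simp
  have "((\<lambda>t. (X t, Y t)) has_derivative (\<lambda>h. (X' * h, Y' * h))) (at t)"
    using X Y by (intro has_derivative_Pair) (auto simp: has_field_derivative_def)
  from diff_chain_at[OF this F]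
  have "((\<lambda>t. F (X t) (Y t)) has_derivative
      (\<lambda>h. Fu (X t) (Y t) * (X' * h) + Fv (X t) (Y t) * (Y' * h))) (at t)" by (simp add: o_def)
  moreover have "(\<lambda>h. Fu (X t) (Y t) * (X' * h) + Fv (X t) (Y t) * (Y' * h)) =
      (*) (Fu (X t) (Y t) * X' + Fv (X t) (Y t) * Y')" by (simp add: fun_eq_iff algebra_simps)
  ultimately show ?thesis by (simp add: has_field_derivative_def)
qed

text \<open>
  The primitive of a periodic function is periodic exactly if the mean vanishes, and then it is
  bounded by its values on one period.
\<close>

lemma prim_bound_of_mean_zero:
  assumes h: "circle_fun h" and zero: "integral {0..1} h = 0" and b: "\<And>u. \<bar>h u\<bar> \<le> B"
  shows "\<bar>prim h u\<bar> \<le> B" and "prim h (u + 1) = prim h u"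
proof -
  show per: "prim h (u + 1) = prim h u" for u using prim_period[OF h] zero by simp
  have c: "continuous_on UNIV h" using h by (simp add: circle_fun_def)
  have B: "0 \<le> B" using b[of 0] by linarith
  have "prim h u = prim h (frac u)"
    using periodic_int_shift[of "prim h" "frac u" "\<lfloor>u\<rfloor>", OF per] by (simp add: frac_def)
  moreover have "\<bar>integral {0..1} (\<lambda>t. h (t * frac u)) - 0\<bar> \<le> B"
    using b by (intro integral_unit_close continuous_compose_UNIV[OF c] continuous_intros) auto
  moreover have "0 \<le> frac u" "frac u \<le> 1" using frac_lt_1[of u] by auto
  ultimately have "\<bar>prim h u\<bar> \<le> 1 * B"
    unfolding prim_def[of h "frac u"] abs_mult by (intro order_trans[OF eq_refl mult_mono] ) (auto simp: abs_mult)
  then show "\<bar>prim h u\<bar> \<le> B" by simp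
qed

text \<open>
  The potential \<open>F\<close> is a primitive of \<open>\<psi> - fibre_mean \<psi>\<close> in the first variable, averaged at scale
  \<open>\<epsilon>\<close> in the second. The primitive is periodic because the mean over each horizontal circle has been
  subtracted. The average is needed because \<open>\<psi>\<close> is only Hoelder continuous in the second variable;
  it replaces \<open>\<partial>\<^sub>u F\<close> by an average of \<open>\<psi> - fibre_mean \<psi>\<close>.
\<close>

lemma potential_exists:
  assumes \<psi>: "torus_holder N \<alpha> \<psi>" and \<epsilon>: "0 < \<epsilon>" and \<alpha>: "0 < \<alpha>"
  obtains F Fu Fv :: "real \<Rightarrow> real \<Rightarrow> real" where
    "torus_fun (\<lambda>(u, v). F u v)" "torus_fun (\<lambda>(u, v). Fu u v)"
    "\<And>u v. ((\<lambda>u. F u v) has_real_derivative Fu u v) (at u)"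
    "\<And>u v. (F u has_real_derivative Fv u v) (at v)"
    "continuous_on UNIV (\<lambda>(u, v). Fv u v)"
    "\<And>u v. \<bar>F u v\<bar> \<le> 2 * N" "\<And>u v. \<bar>Fv u v\<bar> \<le> 4 * N / \<epsilon>"
    "\<And>u v. \<bar>Fu u v - (\<psi> (u, v) - fibre_mean \<psi> v)\<bar> \<le> 2 * N * \<epsilon> powr \<alpha>"
proof -
  have t: "torus_fun \<psi>" and b: "\<And>p. \<bar>\<psi> p\<bar> \<le> N"
    and hol: "\<And>p q. \<bar>\<psi> p - \<psi> q\<bar> \<le> N * dist p q powr \<alpha>"
    using \<psi> by (auto simp: torus_holder_def)
  have N: "0 \<le> N" using b[of "(0, 0)"] by linarith
  define h where "h = (\<lambda>v u. \<psi> (u, v) - fibre_mean \<psi> v)"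
  have hc: "continuous_on S (\<lambda>x. h (a x) (c x))" if "continuous_on S a" "continuous_on S c"
    for a c :: "_ \<Rightarrow> real" and S :: "'z::topological_space set"
    unfolding h_def using that
    by (intro continuous_intros torus_fun_cont[OF t] circle_fun_cont[OF circle_fun_fibre_mean[OF t]])
  have hcu: "continuous_on UNIV (h v)" for v by (intro hc continuous_intros)
  have hv: "circle_fun (h v)" for v
    using t hcu unfolding circle_fun_def by (auto simp: h_def torus_fun_def)
  have hv1: "h (v + 1) = h v" for v
    using t circle_fun_fibre_mean[OF t] by (auto simp: h_def torus_fun_def circle_fun_def)
  have hb: "\<bar>h v u\<bar> \<le> 2 * N" for u v
    using b[of "(u, v)"] fibre_mean_bound[OF t b, of v] by (simp add: h_def)
  have h0: "integral {0..1} (h v) = 0" for v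
  proof -
    have "integral {0..1} (h v) = integral {0..1} (\<lambda>u. \<psi> (u, v)) - integral {0..1} (\<lambda>u::real. fibre_mean \<psi> v)"
      unfolding h_def
      by (rule Henstock_Kurzweil_Integration.integral_diff; rule integrable_continuous_real)
        (intro torus_fun_cont[OF t] continuous_intros)+
    then show ?thesis by (simp add: fibre_mean_def)
  qed
  define R where "R = (\<lambda>u v. prim (h v) u)"
  have Rc: "continuous_on UNIV (\<lambda>(u, v). R u v)"
    unfolding R_def prim_def case_prod_unfold
    by (intro continuous_intros continuous_integral_param hc)
  have Rcv: "continuous_on UNIV (R u)" for u
    using continuous_compose_pair[OF Rc, of UNIV "\<lambda>_. u" "\<lambda>v. v"] by (simp add: continuous_intros)
  have Rb: "\<bar>R u v\<bar> \<le> 2 * N" for u v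
    unfolding R_def by (rule prim_bound_of_mean_zero(1)[OF hv h0 hb])
  have R1: "R (u + 1) = R u" for u
    unfolding R_def using prim_bound_of_mean_zero(2)[OF hv h0 hb] by simp
  have R2: "R u (v + 1) = R u v" for u v unfolding R_def by (simp add: hv1)
  have dR: "((\<lambda>u. R u v) has_real_derivative h v u) (at u)" for u v
    unfolding R_def by (rule prim_has_derivative[OF hcu])
  define F where "F = (\<lambda>u. moving_avg \<epsilon> (R u))"
  define Fu where "Fu = (\<lambda>u. moving_avg \<epsilon> (\<lambda>v. h v u))"
  define Fv where "Fv = (\<lambda>u v. (R u (v + \<epsilon>) - R u v) / \<epsilon>)"
  show thesis
  proof
    have "continuous_on UNIV (\<lambda>p. F (fst p) (snd p))"
      unfolding F_def by (intro continuous_moving_avg Rc continuous_intros)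
    moreover have "F (u + 1) v = F u v" "F u (v + 1) = F u v" for u v
    proof -
      show "F (u + 1) v = F u v" by (simp add: F_def R1)
      have "R u (v + 1 + t) = R u (v + t)" for t using R2[of u "v + t"] by (simp add: algebra_simps)
      then show "F u (v + 1) = F u v" by (simp add: F_def moving_avg_def)
    qed
    ultimately show "torus_fun (\<lambda>(u, v). F u v)" by (simp add: torus_fun_def case_prod_unfold)
    have "continuous_on UNIV (\<lambda>p. Fu (fst p) (snd p))"
      unfolding Fu_def by (rule continuous_moving_avg[where F = "\<lambda>u v. h v u"]) (auto simp: case_prod_unfold intro!: hc continuous_intros)
    moreover have "Fu (u + 1) v = Fu u v" "Fu u (v + 1) = Fu u v" for u v
    proof -
      show "Fu (u + 1) v = Fu u v" using hv unfolding Fu_def circle_fun_def by simp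
      show "Fu u (v + 1) = Fu u v"
        using hv1[of "v + t" for t] by (simp add: Fu_def moving_avg_def algebra_simps)
    qed
    ultimately show "torus_fun (\<lambda>(u, v). Fu u v)" by (simp add: torus_fun_def case_prod_unfold)
    show "((\<lambda>u. F u v) has_real_derivative Fu u v) (at u)" for u v
    proof -
      have "((\<lambda>u. integral (cbox 0 \<epsilon>) (\<lambda>t. R u (v + t))) has_real_derivative
          integral (cbox 0 \<epsilon>) (\<lambda>t. h (v + t) u)) (at u within UNIV)"
      proof (rule leibniz_rule_field_derivative)
        show "((\<lambda>u. R u (v + t)) has_real_derivative h (v + t) u) (at u within UNIV)" for u t
          using dR by simp
        show "(\<lambda>t. R u (v + t)) integrable_on cbox 0 \<epsilon>" for u
          by (intro integrable_continuous continuous_compose_UNIV[OF Rcv] continuous_intros)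
        show "continuous_on (UNIV \<times> cbox 0 \<epsilon>) (\<lambda>(u, t). h (v + t) u)"
          unfolding case_prod_unfold by (intro hc continuous_intros)
      qed auto
      from DERIV_cdivide[OF this, of \<epsilon>] show ?thesis by (simp add: F_def Fu_def moving_avg_def)
    qed
    show "(F u has_real_derivative Fv u v) (at v)" for u v
      unfolding F_def Fv_def by (rule moving_avg_has_derivative[OF Rcv \<epsilon>])
    show "continuous_on UNIV (\<lambda>(u, v). Fv u v)"
      unfolding Fv_def case_prod_unfold using \<epsilon>
      by (intro continuous_intros continuous_compose_pair[OF Rc, simplified]) auto
    show "\<bar>F u v\<bar> \<le> 2 * N" for u v
      using moving_avg_close[OF Rcv[of u] \<epsilon>, where v = v and c = 0 and B = "2 * N"] Rb
      by (simp add: F_def)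
    show "\<bar>Fv u v\<bar> \<le> 4 * N / \<epsilon>" for u v
      using Rb[of u "v + \<epsilon>"] Rb[of u v] \<epsilon> by (simp add: Fv_def divide_right_mono)
    show "\<bar>Fu u v - (\<psi> (u, v) - fibre_mean \<psi> v)\<bar> \<le> 2 * N * \<epsilon> powr \<alpha>" for u v
      unfolding Fu_def
    proof (rule moving_avg_close[OF _ \<epsilon>])
      show "continuous_on UNIV (\<lambda>v. h v u)" by (intro hc continuous_intros)
      fix t assume t: "0 \<le> t" "t \<le> \<epsilon>"
      have p: "t powr \<alpha> \<le> \<epsilon> powr \<alpha>" using t \<alpha> by (intro powr_mono2) auto
      have "\<bar>\<psi> (u, v + t) - \<psi> (u, v)\<bar> \<le> N * t powr \<alpha>"
        using hol[of "(u, v + t)" "(u, v)"] t by (simp add: dist_Pair_Pair dist_real_def)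
      moreover have "\<bar>fibre_mean \<psi> (v + t) - fibre_mean \<psi> v\<bar> \<le> N * t powr \<alpha>"
        using fibre_mean_holder[OF \<psi>, of "v + t" v] t by simp
      ultimately have "\<bar>h (v + t) u - (\<psi> (u, v) - fibre_mean \<psi> v)\<bar> \<le> 2 * (N * t powr \<alpha>)"
        unfolding h_def by linarith
      also have "\<dots> \<le> 2 * (N * \<epsilon> powr \<alpha>)" using p N by (intro mult_left_mono) auto
      finally show "\<bar>h (v + t) u - (\<psi> (u, v) - fibre_mean \<psi> v)\<bar> \<le> 2 * N * \<epsilon> powr \<alpha>" by simp
    qed
  qed
qed

section \<open>Integration by parts along horizontal lines\<close>

context expanding_system
begin

text \<open>
  The factor that turns the \<open>x\<close>-derivative of \<open>F\<close> along the orbit into \<open>\<partial>\<^sub>u F\<close>. Where the denominator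
  vanishes the orbit is not hyperbolic, so the cutoff is 0 in a neighbourhood, and so is the weight.
\<close>

definition weight :: "nat \<Rightarrow> real \<Rightarrow> real \<Rightarrow> real" where
  "weight K x y = chi K x y / dorb g x y (Suc K)"

lemma not_hyperbolic_open: "open {x. \<not> hyperbolic K x y}"
proof -
  have "{x. \<not> hyperbolic K x y} =
      (\<Union>j<K. {x. \<bar>deriv (g (Suc j)) (orb g x y (Suc j))\<bar> < s (Suc j)})"
    by (auto simp: hyperbolic_def not_le)
  moreover have "open {x. \<bar>deriv (g (Suc j)) (orb g x y (Suc j))\<bar> < s (Suc j)}" for j
    by (intro open_Collect_less continuous_intros circle_fun_cont[OF circle_dg] orb_continuous circle_g)
  ultimately show ?thesis by auto
qed

text \<open>
  By the quotient rule, the derivative is the sum of a cutoff term and a curvature term. Where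
  the orbit is not hyperbolic, an open condition, the weight vanishes locally.
\<close>

lemma weight_has_derivative:
  obtains w' where "((\<lambda>x. weight (Suc K) x y) has_real_derivative w') (at x)"
    and "\<bar>w'\<bar> \<le> (28 * \<kappa> + 10) * \<sigma> (Suc K)"
proof (cases "hyperbolic (Suc K) x y")
  case True
  let ?D = "dorb g x y (Suc (Suc K))" and ?E = "ddorb g x y (Suc (Suc K))"
  let ?c = "chi (Suc K) x y" and ?c' = "dchi (Suc K) x y"
  have D: "?D \<noteq> 0" using dorb_growth(2)[OF True, of "Suc K"] by simp
  have "((\<lambda>x. weight (Suc K) x y) has_real_derivative (?c' * ?D - ?c * ?E) / (?D * ?D)) (at x)"
    unfolding weight_def by (rule DERIV_divide[OF chi_has_derivative dorb_has_derivative D])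
  moreover have "\<bar>(?c' * ?D - ?c * ?E) / (?D * ?D)\<bar> \<le> (28 * \<kappa> + 10) * \<sigma> (Suc K)"
  proof -
    have "\<bar>?c' * ?D\<bar> \<le> ((2 + 24 * \<kappa>) * \<sigma> (Suc K) * \<bar>?D\<bar>) * \<bar>?D\<bar>"
      unfolding abs_mult by (intro mult_right_mono dchi_bound[OF True]) auto
    moreover have "\<bar>?c * ?E\<bar> \<le> 1 * ((4 * \<kappa> + 8) * \<sigma> (Suc K) * ?D\<^sup>2)"
      unfolding abs_mult using chi_range[of "Suc K" x y] by (intro mult_mono ddorb_bound[OF True]) auto
    ultimately have "\<bar>?c' * ?D - ?c * ?E\<bar> \<le> (28 * \<kappa> + 10) * \<sigma> (Suc K) * (?D * ?D)"
      by (simp add: power2_eq_square algebra_simps)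
    then show ?thesis using D by (simp add: abs_mult divide_le_eq)
  qed
  ultimately show ?thesis by (rule that)
next
  case False
  have "((\<lambda>x. 0) has_real_derivative 0) (at x)" by simp
  then have "((\<lambda>x. weight (Suc K) x y) has_real_derivative 0) (at x)"
    by (rule has_field_derivative_transform_within_open[OF _ not_hyperbolic_open[of "Suc K" y]])
      (use False chi_outside in \<open>auto simp: weight_def simp del: chi.simps dorb.simps\<close>)
  then show ?thesis using that[of 0] kappa sigma_pos[of K] by simp
qed

text \<open>
  In the second bound, \<open>dorb g x y (Suc K)\<close> is the derivative of the second coordinate of the state: it
  is smaller than that of the first coordinate by the factor \<open>2 / s (Suc K)\<close>.
\<close>

lemma weight_bounds:
  shows "weight (Suc K) x y * dorb g x y (Suc (Suc K)) = chi (Suc K) x y"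
    and "\<bar>weight (Suc K) x y * dorb g x y (Suc K)\<bar> \<le> 2 / s (Suc K)"
    and "\<bar>weight (Suc K) x y\<bar> \<le> (\<Prod>j<Suc K. 2 / s (Suc j))"
proof -
  let ?D = "dorb g x y (Suc (Suc K))"
  have P: "0 \<le> (\<Prod>j<Suc K. 2 / s (Suc j))" using s_pos by (intro prod_nonneg) (auto intro: less_imp_le)
  consider "\<not> hyperbolic (Suc K) x y" | "hyperbolic (Suc K) x y" by blast
  then have "weight (Suc K) x y * ?D = chi (Suc K) x y \<and>
    \<bar>weight (Suc K) x y * dorb g x y (Suc K)\<bar> \<le> 2 / s (Suc K) \<and>
    \<bar>weight (Suc K) x y\<bar> \<le> (\<Prod>j<Suc K. 2 / s (Suc j))"
  proof cases
    case 1
    then have "chi (Suc K) x y = 0" by (rule chi_outside)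
    then show ?thesis using P s_pos[of K] by (simp add: weight_def del: chi.simps)
  next
    case 2
    have D: "?D \<noteq> 0" using dorb_growth(2)[OF 2, of "Suc K"] by simp
    have c: "0 \<le> chi (Suc K) x y" "chi (Suc K) x y \<le> 1" using chi_range[of "Suc K" x y] by auto
    have "s (Suc K) * \<bar>dorb g x y (Suc K)\<bar> \<le> 2 * \<bar>?D\<bar>" using dorb_step(2)[OF 2, of K] by simp
    then have "\<bar>dorb g x y (Suc K)\<bar> / \<bar>?D\<bar> \<le> 2 / s (Suc K)"
      using D s_pos[of K] by (simp add: field_simps)
    then have "chi (Suc K) x y * (\<bar>dorb g x y (Suc K)\<bar> / \<bar>?D\<bar>) \<le> 1 * (2 / s (Suc K))"
      using c by (intro mult_mono) auto
    moreover have "1 / \<bar>?D\<bar> \<le> (\<Prod>j<Suc K. 2 / s (Suc j))"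
      using dorb_lower[OF 2, of "Suc K"] D by (simp add: divide_le_eq mult.commute del: prod.lessThan_Suc)
    then have "chi (Suc K) x y * (1 / \<bar>?D\<bar>) \<le> 1 * (\<Prod>j<Suc K. 2 / s (Suc j))"
      using c by (intro mult_mono) auto
    ultimately show ?thesis
      using D c by (simp add: weight_def abs_mult del: chi.simps prod.lessThan_Suc dorb.simps)
  qed
  then show "weight (Suc K) x y * ?D = chi (Suc K) x y"
    "\<bar>weight (Suc K) x y * dorb g x y (Suc K)\<bar> \<le> 2 / s (Suc K)"
    "\<bar>weight (Suc K) x y\<bar> \<le> (\<Prod>j<Suc K. 2 / s (Suc j))" by auto
qed

lemma dorb_periodic: "dorb g (x + 1) y j = dorb g x y j"
proof -
  have "deriv (g (Suc j)) (orb g (x + 1) y (Suc j)) = deriv (g (Suc j)) (orb g x y (Suc j))" for j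
  proof -
    obtain k where "orb g (x + of_int 1) (y + of_int 0) (Suc j) = orb g x y (Suc j) + of_int k"
      using orb_int_shift[of g x 1 y 0 "Suc j"] circle_g by blast
    then have "orb g (x + 1) y (Suc j) = orb g x y (Suc j) + of_int k" by simp
    then show ?thesis using circle_fun_int_shift[OF circle_dg] by simp
  qed
  then have "dorb g (x + 1) y j = dorb g x y j \<and> dorb g (x + 1) y (Suc j) = dorb g x y (Suc j)"
    by (induction j) auto
  then show ?thesis ..
qed

text \<open>
  The integration by parts. The function \<open>Z = P * weight * F\<close> along the orbit is periodic in \<open>x\<close>, so its
  derivative has integral 0. One term \<open>A\<close> of this derivative is the integrand in question; the
  three others, collected in \<open>B\<close>, come from the slow motion of the second coordinate, from \<open>P\<close> and from
  the weight, and give the three terms of the bound.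
\<close>

lemma oscillatory_integral_bound:
  assumes F: "torus_fun (\<lambda>(u, v). F u v)" "torus_fun (\<lambda>(u, v). Fu u v)"
    and du: "\<And>u v. ((\<lambda>u. F u v) has_real_derivative Fu u v) (at u)"
    and dv: "\<And>u v. (F u has_real_derivative Fv u v) (at v)"
    and cv: "continuous_on UNIV (\<lambda>(u, v). Fv u v)"
    and Fb: "\<And>u v. \<bar>F u v\<bar> \<le> M" "\<And>u v. \<bar>Fv u v\<bar> \<le> M'"
    and P: "\<And>x. (P has_real_derivative P' x) (at x)" "\<And>x. P (x + 1) = P x"
    and Pb: "\<And>x. \<bar>P x\<bar> \<le> N" "\<And>x. \<bar>P' x\<bar> \<le> N'"
  shows "\<bar>integral {0..1} (\<lambda>x. P x * chi (Suc K) x y * Fu (orb g x y (Suc (Suc K))) (orb g x y (Suc K)))\<bar>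
    \<le> N * M' * (2 / s (Suc K)) + N' * M * (\<Prod>j<Suc K. 2 / s (Suc j))
       + N * M * ((28 * \<kappa> + 10) * \<sigma> (Suc K))"
proof -
  let ?X = "\<lambda>x. orb g x y (Suc (Suc K))" and ?Y = "\<lambda>x. orb g x y (Suc K)"
  let ?w = "\<lambda>x. weight (Suc K) x y" and ?\<rho> = "\<Prod>j<Suc K. 2 / s (Suc j)"
  have "\<forall>x. \<exists>d. (?w has_real_derivative d) (at x) \<and> \<bar>d\<bar> \<le> (28 * \<kappa> + 10) * \<sigma> (Suc K)"
    by (rule allI, rule weight_has_derivative, blast)
  from choice[OF this] obtain w' where w': "\<And>x. (?w has_real_derivative w' x) (at x)"
    "\<And>x. \<bar>w' x\<bar> \<le> (28 * \<kappa> + 10) * \<sigma> (Suc K)"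
    by blast
  have N: "0 \<le> N" "0 \<le> N'" using Pb[of 0] by auto
  have M: "0 \<le> M" "0 \<le> M'" using Fb[of 0 0] by auto
  define Z where "Z = (\<lambda>x. P x * ?w x * F (?X x) (?Y x))"
  define A where "A = (\<lambda>x. P x * chi (Suc K) x y * Fu (?X x) (?Y x))"
  define B where "B = (\<lambda>x. P x * Fv (?X x) (?Y x) * (?w x * dorb g x y (Suc K))
      + P' x * F (?X x) (?Y x) * ?w x + P x * F (?X x) (?Y x) * w' x)"
  have dZ: "(Z has_real_derivative A x + B x) (at x)" for x
  proof -
    have "((\<lambda>x. F (?X x) (?Y x)) has_real_derivative
       Fu (?X x) (?Y x) * dorb g x y (Suc (Suc K)) + Fv (?X x) (?Y x) * dorb g x y (Suc K)) (at x)"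
      by (rule has_derivative_of_partials[OF du dv cv orb_has_derivative orb_has_derivative])
    from DERIV_mult[OF DERIV_mult[OF P(1) w'(1)] this]
    have "(Z has_real_derivative (P' x * ?w x + w' x * P x) * F (?X x) (?Y x)
      + (Fu (?X x) (?Y x) * dorb g x y (Suc (Suc K)) + Fv (?X x) (?Y x) * dorb g x y (Suc K)) * (P x * ?w x)) (at x)"
      unfolding Z_def .
    moreover have "A x = P x * (?w x * dorb g x y (Suc (Suc K))) * Fu (?X x) (?Y x)"
      unfolding A_def weight_bounds(1) ..
    ultimately show ?thesis unfolding B_def by (simp add: algebra_simps del: orb.simps dorb.simps)
  qed
  have "Z 1 = Z 0"
  proof -
    have "torus_fun (\<lambda>(x, y). (\<lambda>(u, v). F u v) (orb g x y (Suc (Suc K)), orb g x y (Suc K)))"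
      by (rule torus_fun_orb[of g, OF circle_g F(1)])
    then have "F (?X (x + 1)) (?Y (x + 1)) = F (?X x) (?Y x)" for x
      unfolding torus_fun_def by (auto simp del: orb.simps)
    moreover have "chi (Suc K) (x + 1) y = chi (Suc K) x y" for x
      using torus_fun_chi[of "Suc K"] unfolding torus_fun_def by (auto simp del: chi.simps)
    ultimately have "Z (x + 1) = Z x" for x
      unfolding Z_def weight_def by (simp only: dorb_periodic P(2))
    from this[of 0] show ?thesis by simp
  qed
  have "((\<lambda>x. A x + B x) has_integral (Z 1 - Z 0)) {0..1}"
    using dZ by (intro fundamental_theorem_of_calculus)
      (auto simp flip: has_real_derivative_iff_has_vector_derivative intro: has_field_derivative_at_within)
  then have AB: "((\<lambda>x. A x + B x) has_integral 0) {0..1}" using \<open>Z 1 = Z 0\<close> by simp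
  have cP: "continuous_on {0..1} P"
    by (rule DERIV_continuous_on) (rule has_field_derivative_at_within, rule P(1))
  have "continuous_on {0..1} A"
    unfolding A_def
    by (intro continuous_intros cP torus_fun_cont_case[OF F(2)] torus_fun_cont_case[OF torus_fun_chi]
        orb_continuous circle_g)
  then have A: "(A has_integral integral {0..1} A) {0..1}"
    by (intro integrable_integral integrable_continuous_real)
  have "(B has_integral (0 - integral {0..1} A)) {0..1}"
    using has_integral_diff[OF AB A] by simp
  moreover have Bb: "\<bar>B x\<bar> \<le> N * M' * (2 / s (Suc K)) + N' * M * ?\<rho> + N * M * ((28 * \<kappa> + 10) * \<sigma> (Suc K))" for x
  proof -
    have "\<bar>P x * Fv (?X x) (?Y x) * (?w x * dorb g x y (Suc K))\<bar> \<le> N * M' * (2 / s (Suc K))"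
      unfolding abs_mult[of "P x * Fv (?X x) (?Y x)"] unfolding abs_mult[of "P x"] using N M
      by (intro mult_mono Pb Fb weight_bounds(2)) (auto intro: mult_nonneg_nonneg)
    moreover have "\<bar>P' x * F (?X x) (?Y x) * ?w x\<bar> \<le> N' * M * ?\<rho>"
      unfolding abs_mult using N M
      by (intro mult_mono Pb Fb weight_bounds(3)) (auto intro: mult_nonneg_nonneg)
    moreover have "\<bar>P x * F (?X x) (?Y x) * w' x\<bar> \<le> N * M * ((28 * \<kappa> + 10) * \<sigma> (Suc K))"
      unfolding abs_mult using N M
      by (intro mult_mono Pb Fb w'(2)) (auto intro: mult_nonneg_nonneg)
    ultimately show ?thesis unfolding B_def by linarith
  qed
  moreover have "0 \<le> N * M' * (2 / s (Suc K)) + N' * M * ?\<rho> + N * M * ((28 * \<kappa> + 10) * \<sigma> (Suc K))"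
    using Bb[of 0] by linarith
  ultimately have "norm (0 - integral {0..1} A) \<le>
     (N * M' * (2 / s (Suc K)) + N' * M * ?\<rho> + N * M * ((28 * \<kappa> + 10) * \<sigma> (Suc K))) * measure lborel (cbox 0 (1::real))"
    by (intro has_integral_bound) auto
  then show ?thesis by (simp add: A_def del: prod.lessThan_Suc chi.simps orb.simps)
qed

end

context expanding_system
begin

text \<open>
  The terms of the bound are, in this order: averaging \<open>\<phi>\<close> horizontally at scale \<open>\<delta>\<close>, inserting the
  cutoff, averaging \<open>\<psi>\<close> at scale \<open>\<epsilon>\<close>, and the integration by parts on each horizontal circle. The
  cutoff error is computed map by map because the image of Lebesgue measure under the orbit is
  again Lebesgue measure (\<open>cell_integral_orb1\<close>).
\<close>

lemma fibre_equidistribution: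
  assumes \<psi>: "torus_holder N \<alpha> \<psi>" and \<phi>: "torus_fun \<phi>" "\<And>p. \<bar>\<phi> p\<bar> \<le> N'"
    and H: "\<And>x y t. 0 \<le> t \<Longrightarrow> t \<le> \<delta> \<Longrightarrow> \<bar>\<phi> (x + t, y) - \<phi> (x, y)\<bar> \<le> H"
    and pos: "0 < \<delta>" "0 < \<epsilon>" "0 < \<alpha>"
  shows "\<bar>integral cell (\<lambda>(x, y). \<phi> (x, y) *
      (\<psi> (orb g x y (Suc (Suc K)), orb g x y (Suc K)) - fibre_mean \<psi> (orb g x y (Suc K))))\<bar>
    \<le> H * (2 * N) + N' * (2 * N) * (\<Sum>j<Suc K. integral {0..1} (\<lambda>z. 1 - cut (Suc j) z))
      + N' * (2 * N * \<epsilon> powr \<alpha>)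
      + (N' * (4 * N / \<epsilon>) * (2 / s (Suc K)) + 2 * N' / \<delta> * (2 * N) * (\<Prod>j<Suc K. 2 / s (Suc j))
          + N' * (2 * N) * ((28 * \<kappa> + 10) * \<sigma> (Suc K)))"
    (is "\<bar>integral cell ?I\<bar> \<le> ?e1 + ?e2 + ?e3 + ?e4")
proof -
  have t: "torus_fun \<psi>" and b: "\<And>p. \<bar>\<psi> p\<bar> \<le> N"
    using \<psi> by (auto simp: torus_holder_def)
  have N: "0 \<le> N" using b[of "(0, 0)"] by linarith
  have N': "0 \<le> N'" using \<phi>(2)[of "(0, 0)"] by linarith
  have H0: "0 \<le> H" using H[of 0 0 0] pos by simp
  obtain F Fu Fv where
    F: "torus_fun (\<lambda>(u, v). F u v)" "torus_fun (\<lambda>(u, v). Fu u v)"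
    and du: "\<And>u v. ((\<lambda>u. F u v) has_real_derivative Fu u v) (at u)"
    and dv: "\<And>u v. (F u has_real_derivative Fv u v) (at v)"
    and cv: "continuous_on UNIV (\<lambda>(u, v). Fv u v)"
    and Fb: "\<And>u v. \<bar>F u v\<bar> \<le> 2 * N" "\<And>u v. \<bar>Fv u v\<bar> \<le> 4 * N / \<epsilon>"
    and Fe: "\<And>u v. \<bar>Fu u v - (\<psi> (u, v) - fibre_mean \<psi> v)\<bar> \<le> 2 * N * \<epsilon> powr \<alpha>"
    using potential_exists[OF \<psi> pos(2,3)] by metis
  define P where "P = (\<lambda>y. moving_avg \<delta> (\<lambda>x. \<phi> (x, y)))"
  have cx: "continuous_on UNIV (\<lambda>x. \<phi> (x, y))" for y
    by (intro torus_fun_cont[OF \<phi>(1)] continuous_intros)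
  have tP: "torus_fun (\<lambda>(x, y). P y x)"
  proof -
    have "continuous_on UNIV (\<lambda>p. P (snd p) (fst p))"
      unfolding P_def
      by (rule continuous_moving_avg[where F = "\<lambda>y x. \<phi> (x, y)"])
        (auto simp: case_prod_unfold intro!: torus_fun_cont[OF \<phi>(1)] continuous_intros)
    moreover have "P (y + 1) x = P y x" for x y using \<phi>(1) by (simp add: P_def torus_fun_def)
    moreover have "P y (x + 1) = P y x" for x y
    proof -
      have "\<phi> (x + 1 + t, y) = \<phi> (x + t, y)" for t
        using torus_fun_int_shift[OF \<phi>(1), of "x + t" 1 y 0] by (simp add: algebra_simps)
      then show ?thesis by (simp add: P_def moving_avg_def)
    qed
    ultimately show ?thesis by (simp add: torus_fun_def case_prod_unfold)
  qed
  have Pb: "\<bar>P y x\<bar> \<le> N'" for x y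
    using moving_avg_close[OF cx[of y] pos(1), where v = x and c = 0 and B = N'] \<phi>(2)
    by (simp add: P_def)
  have Pe: "\<bar>P y x - \<phi> (x, y)\<bar> \<le> H" for x y
    unfolding P_def by (rule moving_avg_close[OF cx pos(1)]) (rule H)
  define P' where "P' = (\<lambda>y x. (\<phi> (x + \<delta>, y) - \<phi> (x, y)) / \<delta>)"
  have dP: "(P y has_real_derivative P' y x) (at x)" for x y
    unfolding P_def P'_def by (rule moving_avg_has_derivative[OF cx pos(1)])
  have P'b: "\<bar>P' y x\<bar> \<le> 2 * N' / \<delta>" for x y
    using \<phi>(2)[of "(x + \<delta>, y)"] \<phi>(2)[of "(x, y)"] pos(1) by (simp add: P'_def divide_right_mono)
  define Q where "Q = (\<lambda>(u, v). \<psi> (u, v) - fibre_mean \<psi> v)"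
  have tQ: "torus_fun Q"
    using torus_fun_arith(2)[OF t torus_fun_of_circle_fun(2)[OF circle_fun_fibre_mean[OF t]]]
    by (simp add: Q_def case_prod_unfold)
  have Qb: "\<bar>Q p\<bar> \<le> 2 * N" for p
    using b[of p] fibre_mean_bound[OF t b, of "snd p"] by (auto simp: Q_def case_prod_unfold)
  let ?Q = "\<lambda>p. Q (orb g (fst p) (snd p) (Suc (Suc K)), orb g (fst p) (snd p) (Suc K))"
  let ?V = "\<lambda>p. Fu (orb g (fst p) (snd p) (Suc (Suc K))) (orb g (fst p) (snd p) (Suc K))"
  let ?c = "\<lambda>p. chi (Suc K) (fst p) (snd p)"
  let ?P = "\<lambda>p. P (snd p) (fst p)"
  let ?J = "\<lambda>p. ?P p * ?c p * ?V p"
  let ?B = "\<lambda>p. H * (2 * N) + N' * (2 * N) * (\<Sum>j<Suc K. 1 - cut (Suc j) (orb g (fst p) (snd p) (Suc j)))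
      + N' * (2 * N * \<epsilon> powr \<alpha>)"
  have tQ': "torus_fun ?Q" using torus_fun_orb[of g Q "Suc K", OF circle_g tQ] by (simp add: case_prod_unfold)
  have tV: "torus_fun ?V" using torus_fun_orb[of g "\<lambda>(u, v). Fu u v" "Suc K", OF circle_g F(2)] by (simp add: case_prod_unfold)
  have tI: "torus_fun (\<lambda>p. \<phi> p * ?Q p)" by (rule torus_fun_arith[OF \<phi>(1) tQ'])
  have tJ: "torus_fun ?J"
    using torus_fun_arith(1)[OF torus_fun_arith(1)[OF tP torus_fun_chi[of "Suc K"]] tV]
    by (simp add: case_prod_unfold del: chi.simps orb.simps)
  have cI: "continuous_on UNIV (\<lambda>p. \<phi> p * ?Q p)" and cJ: "continuous_on UNIV ?J"
    using tI tJ by (simp_all add: torus_fun_def)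
  have ccut: "continuous_on UNIV (\<lambda>p. cut (Suc j) (orb g (fst p) (snd p) (Suc j)))" for j
    by (intro circle_fun_cont[OF circle_cut] orb_continuous circle_g continuous_intros)
  have cB: "continuous_on UNIV ?B" by (intro continuous_intros ccut)
  have main: "\<bar>integral cell ?J\<bar> \<le> ?e4"
  proof -
    have eq: "integral cell ?J = integral {0..1} (fibre_mean ?J)"
      using cell_fubini(2)[OF cJ] by (simp add: fibre_mean_def[abs_def])
    have "\<bar>fibre_mean ?J y\<bar> \<le> ?e4" for y
      unfolding fibre_mean_def fst_conv snd_conv
    proof (rule oscillatory_integral_bound[OF F du dv cv Fb dP _ Pb P'b])
      show "P y (x + 1) = P y x" for x using tP by (simp add: torus_fun_def)
    qed
    then have "\<bar>integral {0..1} (fibre_mean ?J) - 0\<bar> \<le> ?e4"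
      using circle_fun_fibre_mean[OF tJ]
      by (intro integral_unit_close) (auto simp: circle_fun_def)
    then show ?thesis by (simp only: eq diff_zero)
  qed
  have "\<bar>integral cell (\<lambda>p. \<phi> p * ?Q p - ?J p)\<bar> \<le> integral cell ?B"
  proof (rule cell_bound)
    show "continuous_on UNIV (\<lambda>p. \<phi> p * ?Q p - ?J p)" by (intro continuous_on_diff cI cJ)
    show "continuous_on UNIV ?B" by (rule cB)
    fix p
    have c: "0 \<le> ?c p" "?c p \<le> 1" using chi_range by blast+
    \<comment> \<open>Replace \<open>\<phi>\<close> by its average, insert the cutoff, replace \<open>Q\<close> by \<open>\<partial>\<^sub>u F\<close>.\<close>
    have "\<phi> p * ?Q p - ?J p = (\<phi> p - ?P p) * ?Q p + ?P p * (1 - ?c p) * ?Q p + ?P p * ?c p * (?Q p - ?V p)"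
      by (simp add: algebra_simps)
    moreover have "\<bar>(\<phi> p - ?P p) * ?Q p\<bar> \<le> H * (2 * N)"
      unfolding abs_mult using Pe[of "snd p" "fst p"] H0
      by (intro mult_mono Qb) (auto simp: abs_minus_commute)
    moreover have "\<bar>?P p * (1 - ?c p) * ?Q p\<bar> \<le>
        N' * (\<Sum>j<Suc K. 1 - cut (Suc j) (orb g (fst p) (snd p) (Suc j))) * (2 * N)"
      unfolding abs_mult using c chi_defect[of "Suc K" "fst p" "snd p"] N' cut_range
      by (intro mult_mono Qb Pb) (auto intro!: mult_nonneg_nonneg sum_nonneg simp del: chi.simps sum.lessThan_Suc)
    moreover have "\<bar>?P p * ?c p * (?Q p - ?V p)\<bar> \<le> N' * 1 * (2 * N * \<epsilon> powr \<alpha>)"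
      unfolding abs_mult using c N'
      by (intro mult_mono Pb) (use Fe in \<open>auto simp: abs_minus_commute Q_def simp del: chi.simps\<close>)
    ultimately show "\<bar>\<phi> p * ?Q p - ?J p\<bar> \<le> ?B p" by (simp only: mult_1_right mult.assoc mult.commute[of _ "2 * N"])
  qed
  moreover have "integral cell ?B = ?e1 + ?e2 + ?e3"
  proof -
    have "integral cell (\<lambda>p. 1 - cut (Suc j) (orb g (fst p) (snd p) (Suc j))) =
        integral {0..1} (\<lambda>z. 1 - cut (Suc j) z)" for j
    proof -
      have "circle_fun (\<lambda>z. 1 - cut (Suc j) z)"
        using circle_cut[of j] unfolding circle_fun_def by (auto intro: continuous_on_diff continuous_on_const)
      from cell_integral_orb1[of g _ "Suc j", OF circle_g this] show ?thesis
        by (simp add: case_prod_unfold)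
    qed
    moreover have "((\<lambda>p. 1 - cut (Suc j) (orb g (fst p) (snd p) (Suc j))) has_integral
       integral cell (\<lambda>p. 1 - cut (Suc j) (orb g (fst p) (snd p) (Suc j)))) cell" for j
      by (intro integrable_integral cell_integrable continuous_intros ccut)
    ultimately have j: "((\<lambda>p. 1 - cut (Suc j) (orb g (fst p) (snd p) (Suc j))) has_integral
       integral {0..1} (\<lambda>z. 1 - cut (Suc j) z)) cell" for j by simp
    have const: "((\<lambda>p. c) has_integral c) cell" for c :: real
      using has_integral_const[of c "(0::real, 0::real)" "(1, 1)"] by (simp add: content_Pair)
    have "(?B has_integral ?e1 + ?e2 + ?e3) cell"
      by (intro has_integral_add has_integral_mult_right has_integral_sum j const) auto
    then show ?thesis by (rule integral_unique)
  qed
  moreover have "integral cell (\<lambda>p. \<phi> p * ?Q p - ?J p) = integral cell (\<lambda>p. \<phi> p * ?Q p) - integral cell ?J"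
    by (intro Henstock_Kurzweil_Integration.integral_diff cell_integrable cI cJ)
  moreover have "integral cell ?I = integral cell (\<lambda>p. \<phi> p * ?Q p)"
    by (simp add: case_prod_unfold Q_def)
  ultimately show ?thesis using main by linarith
qed

text \<open>
  The integrand is at most 1 and vanishes outside the intervals of radius \<open>r\<close> around the points of
  \<open>C\<close> and their translates. Three translates of each interval meet the unit interval if \<open>r < 1\<close>.
\<close>

lemma cut_defect_integral:
  assumes fin: "finite C" and ne: "C \<noteq> {}" and C01: "C \<subseteq> {0..1}" and r: "0 < r"
    and near: "\<And>x. \<bar>deriv (g (Suc j)) x\<bar> < 3 / 2 * s (Suc j) \<Longrightarrow> \<exists>c\<in>C. \<exists>k::int. \<bar>x - c - of_int k\<bar> \<le> r"
  shows "integral {0..1} (\<lambda>z. 1 - cut (Suc j) z) \<le> 6 * r * card C"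
proof -
  have c: "continuous_on UNIV (\<lambda>z. 1 - cut (Suc j) z)"
    using circle_cut[of j] by (auto simp: circle_fun_def intro!: continuous_intros)
  have card: "1 \<le> real (card C)" using fin ne by (simp add: Suc_le_eq card_gt_0_iff)
  show ?thesis
  proof (cases "r < 1")
    case False
    have "\<bar>integral {0..1} (\<lambda>z. 1 - cut (Suc j) z) - 0\<bar> \<le> 1"
      using cut_range by (intro integral_unit_close c) (auto simp: abs_le_iff intro: order_trans[of _ 0])
    also have "1 \<le> 6 * r * card C"
      using mult_mono[of 1 "6 * r" 1 "real (card C)"] False card by simp
    finally show ?thesis by simp
  next
    case True
    define I where "I = (\<lambda>q. {fst q + of_int (snd q) - r .. fst q + of_int (snd q) + r})"
    define D where "D = C \<times> {-1, 0, 1::int}"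
    have finD: "finite D" using fin by (simp add: D_def)
    have "((\<lambda>z. 1 - cut (Suc j) z) has_integral integral {0..1} (\<lambda>z. 1 - cut (Suc j) z)) {0..1}"
      using continuous_on_subset[OF c] by (intro integrable_integral integrable_continuous_real) auto
    then have A: "((\<lambda>z. if z \<in> {0..1} then 1 - cut (Suc j) z else 0) has_integral
        integral {0..1} (\<lambda>z. 1 - cut (Suc j) z)) UNIV"
      by (simp only: has_integral_restrict_UNIV)
    have "((\<lambda>z. if z \<in> I q then 1 else 0) has_integral (2 * r)) UNIV" for q
      unfolding has_integral_restrict_UNIV I_def
      using has_integral_const_real[of "1::real" "fst q + of_int (snd q) - r" "fst q + of_int (snd q) + r"] r
      by simp
    then have B: "((\<lambda>z. \<Sum>q\<in>D. if z \<in> I q then 1 else 0) has_integral (\<Sum>q\<in>D. 2 * r)) UNIV"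
      by (intro has_integral_sum finD) auto
    have "integral {0..1} (\<lambda>z. 1 - cut (Suc j) z) \<le> (\<Sum>q\<in>D. 2 * r)"
    proof (rule has_integral_le[OF A B])
      fix z :: real
      let ?T = "\<Sum>q\<in>D. if z \<in> I q then 1 else 0 :: real"
      have T: "0 \<le> ?T" by (intro sum_nonneg) auto
      show "(if z \<in> {0..1} then 1 - cut (Suc j) z else 0) \<le> ?T"
      proof (cases "z \<in> {0..1} \<and> \<bar>deriv (g (Suc j)) z\<bar> < 3 / 2 * s (Suc j)")
        case False
        then show ?thesis using T cut_high[of j z] by auto
      next
        case z: True
        then obtain c k where ck: "c \<in> C" "\<bar>z - c - of_int k\<bar> \<le> r" using near by blast
        have "\<bar>z - c\<bar> \<le> 1" using z ck(1) C01 by (auto simp: abs_le_iff)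
        then have "\<bar>of_int k :: real\<bar> < 2" using ck(2) True by linarith
        then have "k \<in> {-1, 0, 1}" by auto
        then have q: "(c, k) \<in> D" "z \<in> I (c, k)" using ck by (auto simp: D_def I_def abs_le_iff)
        have "1 - cut (Suc j) z \<le> (if z \<in> I (c, k) then 1 else 0)" using q cut_range by simp
        also have "\<dots> \<le> ?T" by (rule member_le_sum[OF q(1) _ finD]) auto
        finally show ?thesis using z by simp
      qed
    qed
    also have "\<dots> = 6 * r * card C" by (simp add: D_def card_cartesian_product)
    finally show ?thesis .
  qed
qed

end

section \<open>Consequences of the hypotheses on one map\<close>

lemma deriv_periodic:
  fixes f :: "real \<Rightarrow> real"
  assumes "\<And>x. f (x + 1) = f x"
  shows "deriv f (x + 1) = deriv f x"
  using DERIV_shift[of f _ x 1] assms by (simp add: deriv_def)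

lemma map_hyps_regular:
  assumes "map_hyps M K\<^sub>0 K\<^sub>1 l f"
  shows "f (x + 1) = f x"
    and "(f has_real_derivative deriv f x) (at x)"
    and "(deriv f has_real_derivative deriv (deriv f) x) (at x)"
    and "\<bar>deriv f x\<bar> \<le> K\<^sub>0 * l" and "\<bar>deriv (deriv f) x\<bar> \<le> K\<^sub>0 * l"
proof -
  have C3: "C3_circle f" and sup: "sup_norm_on circle (deriv f) + sup_norm_on circle (deriv (deriv f)) \<le> K\<^sub>0 * l"
    using assms by (auto simp: map_hyps_def)
  show per: "f (x + 1) = f x" for x using C3 by (simp add: C3_circle_def)
  have diff: "((deriv ^^ k) f) differentiable (at x)" if "k < 3" for k x
    using C3 that by (auto simp: C3_circle_def)
  show d1: "(f has_real_derivative deriv f x) (at x)" for x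
    using diff[of 0 x] by (simp add: DERIV_deriv_iff_real_differentiable)
  show d2: "(deriv f has_real_derivative deriv (deriv f) x) (at x)" for x
    using diff[of 1 x] by (simp add: DERIV_deriv_iff_real_differentiable)
  have d3: "deriv (deriv f) differentiable (at x)" for x
    using diff[of 2 x] by (simp add: numeral_2_eq_2)
  have p1: "deriv f (x + 1) = deriv f x" for x by (rule deriv_periodic) (rule per)
  have p2: "deriv (deriv f) (x + 1) = deriv (deriv f) x" for x by (rule deriv_periodic) (rule p1)
  have bound: "\<bar>h x\<bar> \<le> sup_norm_on circle h \<and> 0 \<le> sup_norm_on circle h"
    if h: "continuous_on UNIV h" "\<And>x. h (x + 1) = h x" for h x
  proof -
    have "compact ((\<lambda>x. \<bar>h x\<bar>) ` {0..1})"
      using h(1) by (intro compact_continuous_image continuous_on_subset[OF continuous_on_rabs]) auto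
    then have "bdd_above ((\<lambda>x. \<bar>h x\<bar>) ` {0..1})" by (intro bounded_imp_bdd_above compact_imp_bounded)
    then have "bdd_above ((\<lambda>x. \<bar>h x\<bar>) ` circle)" by (rule bdd_above_mono) (auto simp: circle_def)
    then have "\<bar>h (frac x)\<bar> \<le> sup_norm_on circle h"
      unfolding sup_norm_on_def by (intro cSUP_upper) (auto simp: circle_def frac_lt_1)
    moreover have "h (frac x) = h x"
      using periodic_int_shift[of h "frac x" "\<lfloor>x\<rfloor>", OF h(2)] by (simp add: frac_def)
    ultimately show ?thesis by (smt (verit))
  qed
  have c1: "continuous_on UNIV (deriv f)"
    by (rule DERIV_continuous_on[OF has_field_derivative_at_within[OF d2]])
  have c2: "continuous_on UNIV (deriv (deriv f))"
    using d3 by (intro differentiable_imp_continuous_on) (auto simp: differentiable_on_def intro: differentiable_at_withinI)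
  show "\<bar>deriv f x\<bar> \<le> K\<^sub>0 * l" "\<bar>deriv (deriv f) x\<bar> \<le> K\<^sub>0 * l"
    using bound[OF c1 p1, of x] bound[OF c2 p2, of x] sup by linarith+
qed

lemma map_hyps_circle_fun:
  assumes "map_hyps M K\<^sub>0 K\<^sub>1 l f"
  shows "circle_fun f"
  unfolding circle_fun_def
  using DERIV_continuous_on[OF has_field_derivative_at_within[OF map_hyps_regular(2)[OF assms]]]
    map_hyps_regular(1)[OF assms] by blast

text \<open>
  There is a critical point by Rolle's theorem on one period.
\<close>

lemma map_hyps_crit:
  assumes f: "map_hyps M K\<^sub>0 K\<^sub>1 l f"
  shows "crit f \<noteq> {}" and "finite (crit f)" and "card (crit f) \<le> M" and "crit f \<subseteq> {0..1}"
proof -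
  show "finite (crit f)" and "card (crit f) \<le> M" and "crit f \<subseteq> {0..1}"
    using f by (auto simp: map_hyps_def crit_def circle_def)
  have "\<exists>z>0. z < 1 \<and> DERIV f z :> 0"
  proof (rule Rolle)
    show "f 0 = f 1" using map_hyps_regular(1)[OF f, of 0] by simp
    show "continuous_on {0..1} f"
      by (rule DERIV_continuous_on[OF has_field_derivative_at_within[OF map_hyps_regular(2)[OF f]]])
    show "\<And>x. 0 < x \<Longrightarrow> x < 1 \<Longrightarrow> f differentiable (at x)"
      using map_hyps_regular(2)[OF f] real_differentiable_def by blast
  qed simp
  then obtain z where "0 < z" "z < 1" "DERIV f z :> 0" by blast
  then have "z \<in> crit f" using DERIV_imp_deriv by (auto simp: crit_def circle_def)
  then show "crit f \<noteq> {}" by blast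
qed

text \<open>
  The third hypothesis on the maps, read backwards. The set of critical points is finite and
  nonempty, so the infimum of the distances is meaningful and a bound on it yields an actual critical
  point, and then an integer translate of it.
\<close>

lemma map_hyps_near_critical:
  assumes f: "map_hyps M K\<^sub>0 K\<^sub>1 l f" and pos: "0 < l" "0 < K\<^sub>1"
    and x: "\<bar>deriv f x\<bar> < l / K\<^sub>1 * r"
  shows "\<exists>c\<in>crit f. \<exists>k::int. \<bar>x - c - of_int k\<bar> \<le> r"
proof -
  note ne = map_hyps_crit(1)[OF f] and fin = map_hyps_crit(2)[OF f]
  have per: "deriv f (x + 1) = deriv f x" for x
    by (rule deriv_periodic) (rule map_hyps_regular(1)[OF f])
  define z where "z = frac x"
  have z: "z \<in> circle" by (auto simp: z_def circle_def frac_lt_1)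
  have "deriv f z = deriv f x"
    using periodic_int_shift[of "deriv f" "frac x" "\<lfloor>x\<rfloor>", OF per]
    by (simp add: frac_def z_def)
  moreover have "\<bar>deriv f z\<bar> \<ge> l * inverse K\<^sub>1 * (INF c\<in>crit f. circle_dist z c)"
    using f z by (auto simp: map_hyps_def)
  ultimately have "l / K\<^sub>1 * (INF c\<in>crit f. circle_dist z c) < l / K\<^sub>1 * r"
    using x by (simp add: divide_inverse)
  then have "(INF c\<in>crit f. circle_dist z c) < r" using pos by (simp add: field_simps)
  then obtain c where c: "c \<in> crit f" "circle_dist z c < r"
    using cINF_less_iff[OF ne, of "circle_dist z" r] fin by auto
  have "\<exists>k\<in>\<int>. dist z (c + k) < r"
    using c(2) unfolding circle_dist_def
    by (subst (asm) cINF_less_iff) (auto intro!: bdd_belowI2[of _ 0])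
  then obtain k :: int where "\<bar>z - (c + of_int k)\<bar> < r" by (auto simp: dist_real_def elim!: Ints_cases)
  then have "\<bar>x - c - of_int (k + \<lfloor>x\<rfloor>)\<bar> \<le> r" by (simp add: z_def frac_def algebra_simps)
  then show ?thesis using c(1) by blast
qed

section \<open>Choice of scales\<close>

text \<open>
  The first product bounds how much the past up to time \<open>m\<close> can shrink the scale of an observable, the
  second one how much the later maps shrink horizontal scales under the inverse. With
  \<open>l = L m\<close>, the former is at most \<open>((K\<^sub>0 + 1) * l) ^ m\<close>, and \<open>\<eta> > 1/2\<close> together with \<open>6 * m\<close> steps makes
  the latter at most \<open>(64 / l ^ 3) ^ m\<close>.
\<close>

lemma expansion_beats_contraction:
  fixes L :: "nat \<Rightarrow> real"
  assumes L: "incseq L" "\<And>i. 1 \<le> i \<Longrightarrow> 64 * (K\<^sub>0 + 1) \<le> L i" "1 \<le> L m"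
    and K: "0 < K\<^sub>0" "6 * m \<le> Suc K" and \<eta>: "1/2 < \<eta>" "\<eta> < 1"
  shows "(\<Prod>i=1..m. K\<^sub>0 * L i + 1) * (\<Prod>j<Suc K. 2 / L (m + Suc j) powr \<eta>) \<le> 2 * L m powr (- (1 - \<eta>))"
proof -
  have L64: "64 \<le> L i" if "1 \<le> i" for i using L(2)[OF that] K(1) mult_left_mono[of 1 "K\<^sub>0 + 1" 64] by simp
  have sq: "sqrt (L m) \<le> L (m + Suc j) powr \<eta>" for j
  proof -
    have "sqrt (L m) \<le> sqrt (L (m + Suc j))" using L(1) by (simp add: incseq_def)
    also have "\<dots> = L (m + Suc j) powr (1/2)" using L64[of "m + Suc j"] by (simp add: powr_half_sqrt)
    also have "\<dots> \<le> L (m + Suc j) powr \<eta>" using L64[of "m + Suc j"] \<eta> by (intro powr_mono) auto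
    finally show ?thesis .
  qed
  have le1: "2 / L (m + Suc j) powr \<eta> \<le> 1" for j
  proof -
    have "(2::real) \<le> sqrt (L (m + Suc j))" using L64[of "m + Suc j"] by (intro real_le_rsqrt) simp
    also have "\<dots> = L (m + Suc j) powr (1/2)" using L64[of "m + Suc j"] by (simp add: powr_half_sqrt)
    also have "\<dots> \<le> L (m + Suc j) powr \<eta>" using L64[of "m + Suc j"] \<eta> by (intro powr_mono) auto
    finally show ?thesis by (subst divide_le_eq_1_pos) linarith+
  qed
  show ?thesis
  proof (cases "m = 0")
    case True
    have "(\<Prod>j<K. 2 / L (m + Suc j) powr \<eta>) \<le> 1" by (intro prod_le_1) (use le1 in auto)
    moreover have "L m powr \<eta> \<le> L (m + Suc K) powr \<eta>" using L \<eta> by (intro powr_mono2) (auto simp: incseq_def)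
    then have "2 / L (m + Suc K) powr \<eta> \<le> 2 / L m powr \<eta>" using L(3) L64[of "m + Suc K"]
      by (intro divide_left_mono mult_pos_pos) auto
    moreover have "2 / L m powr \<eta> \<le> 2 * L m powr (- (1 - \<eta>))"
    proof -
      have "L m powr (- \<eta>) \<le> L m powr (- (1 - \<eta>))" using L(3) \<eta> by (intro powr_mono) auto
      then show ?thesis by (simp add: powr_minus_divide)
    qed
    ultimately have "(\<Prod>j<K. 2 / L (m + Suc j) powr \<eta>) * (2 / L (m + Suc K) powr \<eta>)
        \<le> 1 * (2 * L m powr (- (1 - \<eta>)))"
      by (intro mult_mono) auto
    then show ?thesis using True by simp
  next
    case False
    define l where "l = L m"
    have l: "64 * (K\<^sub>0 + 1) \<le> l" "64 \<le> l" using L(2)[of m] L64[of m] False by (auto simp: l_def)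
    have "(\<Prod>i=1..m. K\<^sub>0 * L i + 1) \<le> (\<Prod>i=1..m. (K\<^sub>0 + 1) * l)"
    proof (intro prod_mono conjI)
      fix i assume i: "i \<in> {1..m}"
      have "L i \<le> l" using L(1) i by (simp add: l_def incseq_def)
      then have "K\<^sub>0 * L i \<le> K\<^sub>0 * l" using K by (intro mult_left_mono) auto
      then show "K\<^sub>0 * L i + 1 \<le> (K\<^sub>0 + 1) * l" using l by (simp add: algebra_simps)
      show "0 \<le> K\<^sub>0 * L i + 1" using L64[of i] i K by (simp add: add_nonneg_nonneg)
    qed
    then have A: "(\<Prod>i=1..m. K\<^sub>0 * L i + 1) \<le> ((K\<^sub>0 + 1) * l) ^ m" by simp
    have "(\<Prod>j<Suc K. 2 / L (m + Suc j) powr \<eta>) \<le> (\<Prod>j<Suc K. 2 / sqrt l)"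
    proof (intro prod_mono conjI divide_left_mono mult_pos_pos)
      fix j
      show "sqrt l \<le> L (m + Suc j) powr \<eta>" using sq[of j] by (simp add: l_def)
      show "0 < L (m + Suc j) powr \<eta>" using L64[of "m + Suc j"] by auto
    qed (use l in auto)
    also have "\<dots> = (2 / sqrt l) ^ Suc K" by simp
    also have "\<dots> \<le> (2 / sqrt l) ^ (6 * m)"
    proof (rule power_decreasing[OF K(2)])
      have "(2::real) \<le> sqrt l" using l by (intro real_le_rsqrt) simp
      then show "2 / sqrt l \<le> 1" by (subst divide_le_eq_1_pos) linarith+
    qed (use l in simp)
    also have "\<dots> = ((2 / sqrt l) ^ 6) ^ m" by (simp add: power_mult)
    also have "(2 / sqrt l) ^ 6 = 64 / l ^ 3"
    proof -
      have "sqrt l ^ 6 = ((sqrt l)\<^sup>2) ^ 3" by (simp flip: power_mult)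
      then have "sqrt l ^ 6 = l ^ 3" using l by simp
      then show ?thesis by (simp add: power_divide)
    qed
    finally have B: "(\<Prod>j<Suc K. 2 / L (m + Suc j) powr \<eta>) \<le> (64 / l ^ 3) ^ m" .
    have "(\<Prod>i=1..m. K\<^sub>0 * L i + 1) * (\<Prod>j<Suc K. 2 / L (m + Suc j) powr \<eta>)
        \<le> ((K\<^sub>0 + 1) * l) ^ m * (64 / l ^ 3) ^ m"
    proof (rule mult_mono[OF A B])
      show "0 \<le> ((K\<^sub>0 + 1) * l) ^ m" using l K by simp
      show "0 \<le> (\<Prod>j<Suc K. 2 / L (m + Suc j) powr \<eta>)" by (intro prod_nonneg) simp
    qed
    also have "\<dots> = ((K\<^sub>0 + 1) * l * (64 / l ^ 3)) ^ m" by (rule power_mult_distrib[symmetric])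
    also have "\<dots> \<le> (1 / l) ^ m"
    proof (rule power_mono)
      have "64 * (K\<^sub>0 + 1) * l\<^sup>2 \<le> l * l\<^sup>2" using l by (intro mult_right_mono) auto
      then show "(K\<^sub>0 + 1) * l * (64 / l ^ 3) \<le> 1 / l"
        using l by (simp add: field_simps power2_eq_square power3_eq_cube)
    qed (use l K in auto)
    also have "\<dots> \<le> (1 / l) ^ 1" using False l by (intro power_decreasing) auto
    also have "\<dots> = l powr (- 1)" using l by (simp add: powr_minus_divide)
    also have "\<dots> \<le> l powr (- (1 - \<eta>))" using l \<eta> by (intro powr_mono) auto
    also have "\<dots> \<le> 2 * l powr (- (1 - \<eta>))" by simp
    finally show ?thesis by (simp add: l_def)
  qed
qed

text \<open>
  The bound of \<open>fibre_equidistribution\<close> after the choice of scales, with the dynamics started at time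
  \<open>m\<close>. Since the first term of \<open>S\<close> is \<open>L m powr (- (1 - \<eta>) / 2)\<close>, any gain of
  \<open>L m powr (- (1 - \<eta>))\<close> is a gain of \<open>S\<^sup>2\<close>, which is enough to pay for one factor \<open>1 / \<epsilon>\<close>.
\<close>

lemma observable_decouples:
  assumes sys: "system_hyps M K\<^sub>0 K\<^sub>1 L f" and K: "0 < K\<^sub>0" "0 < K\<^sub>1" and \<eta>: "1/2 < \<eta>" "\<eta> < 1"
    and large: "\<And>i. 1 \<le> i \<Longrightarrow> 64 * (K\<^sub>0 + 1) \<le> L i"
      "\<And>i. 1 \<le> i \<Longrightarrow> (32 * K\<^sub>0 + 16) * L i powr (1 - 2 * \<eta>) \<le> 1"
    and summ: "summable (\<lambda>i. L i powr (- (1/2) * (1 - \<eta>)))"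
    and \<alpha>: "0 < \<alpha>" "\<alpha> \<le> 1"
    and \<phi>: "torus_holder N' \<alpha> \<phi>" and \<psi>: "torus_holder N \<alpha> \<psi>"
    and mK: "6 * m \<le> Suc K"
    and S: "S = (\<Sum>i. L (m + i) powr (- (1/2) * (1 - \<eta>)))" "S < 1"
    and g: "g = (\<lambda>j. f (m + j))"
  shows "\<bar>integral cell (\<lambda>(x, y). pullback f \<phi> m (x, y) *
      (\<psi> (orb g x y (Suc (Suc K)), orb g x y (Suc K)) - fibre_mean \<psi> (orb g x y (Suc K))))\<bar>
    \<le> N * N' * ((28 + 18 * real M * K\<^sub>1) * S powr (\<alpha> / (\<alpha> + 2))
        + (56 * K\<^sub>0 + 20) * L (m + Suc K) powr (1 - 2 * \<eta>))"
proof -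
  have L0: "0 < L 0" and inc: "incseq L" and hyps: "\<And>n. 1 \<le> n \<Longrightarrow> map_hyps M K\<^sub>0 K\<^sub>1 (L n) (f n)"
    using sys by (auto simp: system_hyps_def)
  have Lpos: "0 < L i" for i using L0 inc by (meson incseq_def le0 less_le_trans)
  have N: "0 \<le> N" "0 \<le> N'" using \<phi> \<psi> unfolding torus_holder_def by (meson abs_ge_zero order_trans)+
  let ?p = "- (1/2) * (1 - \<eta>)"
  have summ': "summable (\<lambda>i. L (m + i) powr ?p)"
    using summ summable_iff_shift[of "\<lambda>i. L i powr ?p" m] by (simp add: add.commute)
  have term_le: "(\<Sum>i\<in>I. L (m + i) powr ?p) \<le> S" if "finite I" for I
    unfolding S(1) using that summ' by (intro sum_le_suminf) auto
  have Lm_S: "L m powr ?p \<le> S" using term_le[of "{0}"] by simp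
  then have S0: "0 < S" using Lpos[of m] by (smt (verit) powr_gt_zero)
  have Lm1: "1 \<le> L m"
  proof (rule ccontr)
    assume "\<not> 1 \<le> L m"
    then have "1 powr ?p \<le> L m powr ?p" using Lpos[of m] \<eta> by (intro powr_mono2') auto
    then show False using Lm_S S(2) by simp
  qed
  have LmS2: "L m powr (- (1 - \<eta>)) \<le> S\<^sup>2"
  proof -
    have "L m powr (- (1 - \<eta>)) = (L m powr ?p)\<^sup>2"
      using Lpos[of m] by (simp add: power2_eq_square flip: powr_add)
    then show ?thesis using power_mono[OF Lm_S, of 2] by simp
  qed
  have L1: "1 \<le> L (m + j)" for j using Lm1 inc by (meson incseq_def le_add1 order_trans)
  define s where "s = (\<lambda>j. L (m + j) powr \<eta>)"
  define \<sigma> where "\<sigma> = (\<lambda>j. L (m + j) powr (1 - 2 * \<eta>))"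
  have gj: "map_hyps M K\<^sub>0 K\<^sub>1 (L (m + Suc j)) (g (Suc j))" for j unfolding g by (rule hyps) simp
  interpret expanding_system g s \<sigma> K\<^sub>0
  proof
    fix j x
    note r = map_hyps_regular[OF gj[of j]]
    show "g (Suc j) (x + 1) = g (Suc j) x" by (rule r)
    show "(g (Suc j) has_real_derivative deriv (g (Suc j)) x) (at x)" by (rule r)
    show "(deriv (g (Suc j)) has_real_derivative deriv (deriv (g (Suc j))) x) (at x)" by (rule r)
    have "\<sigma> (Suc j) * (s (Suc j))\<^sup>2 = L (m + Suc j)"
      using Lpos[of "m + Suc j"] by (simp add: \<sigma>_def s_def power2_eq_square flip: powr_add)
    then show "\<bar>deriv (deriv (g (Suc j))) x\<bar> \<le> K\<^sub>0 * \<sigma> (Suc j) * (s (Suc j))\<^sup>2"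
      using r(5)[of x] by (simp add: mult.assoc)
    show "0 < s (Suc j)" using Lpos[of "m + Suc j"] by (simp add: s_def)
    have "L (m + Suc j) powr (- \<eta>) \<le> L (m + Suc j) powr (1 - 2 * \<eta>)"
      using L1[of "Suc j"] \<eta> by (intro powr_mono) auto
    then show "1 / s (Suc j) \<le> \<sigma> (Suc j)" by (simp add: s_def \<sigma>_def powr_minus_divide)
    show "(32 * K\<^sub>0 + 16) * \<sigma> (Suc j) \<le> 1" unfolding \<sigma>_def by (rule large(2)) simp
  qed (use K in auto)
  have circ: "circle_fun (f (Suc j))" for j by (rule map_hyps_circle_fun[OF hyps]) simp
  define A where "A = (\<Prod>i=1..m. K\<^sub>0 * L i + 1)"
  have A1: "0 < A" unfolding A_def using Lpos K by (intro prod_pos) (simp add: add_pos_pos)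
  define \<rho> where "\<rho> = (\<Prod>j<Suc K. 2 / s (Suc j))"
  have A\<rho>: "A * \<rho> \<le> 2 * S\<^sup>2"
    using expansion_beats_contraction[of L K\<^sub>0 m K \<eta>, OF inc large(1) Lm1 K(1) mK \<eta>] LmS2
    by (simp add: A_def \<rho>_def s_def del: prod.lessThan_Suc)
  define \<beta> where "\<beta> = S powr (\<alpha> / (\<alpha> + 2))"
  define \<epsilon> where "\<epsilon> = S powr (1 / (\<alpha> + 2))"
  \<comment> \<open>The pullback of \<open>\<phi>\<close> to time \<open>m\<close> varies at scale \<open>\<delta>\<close> no more than \<open>\<phi>\<close> itself does at scale \<open>\<epsilon>\<close>.\<close>
  define \<delta> where "\<delta> = \<epsilon> / (2 * A)"
  have \<epsilon>: "0 < \<epsilon>" using S0 by (simp add: \<epsilon>_def)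
  have \<delta>: "0 < \<delta>" using \<epsilon> A1 by (simp add: \<delta>_def)
  have \<epsilon>\<alpha>: "\<epsilon> powr \<alpha> = \<beta>" by (simp add: \<epsilon>_def \<beta>_def powr_powr)
  have S_\<beta>: "S \<le> \<beta>"
  proof -
    have "S powr 1 \<le> S powr (\<alpha> / (\<alpha> + 2))" using S0 S(2) \<alpha> by (intro powr_mono') auto
    then show ?thesis using S0 by (simp add: \<beta>_def)
  qed
  have S2\<epsilon>: "S\<^sup>2 / \<epsilon> \<le> \<beta>"
  proof -
    have "S\<^sup>2 / \<epsilon> = S powr (2 - 1 / (\<alpha> + 2))"
      using S0 by (simp add: \<epsilon>_def powr_diff)
    also have "\<dots> \<le> S powr (\<alpha> / (\<alpha> + 2))"
      using S0 S(2) \<alpha> by (intro powr_mono') (auto simp: field_simps)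
    finally show ?thesis by (simp add: \<beta>_def)
  qed
  have sK: "1 / s (Suc K) \<le> S\<^sup>2"
  proof -
    have "L m powr \<eta> \<le> s (Suc K)" unfolding s_def using Lm1 inc \<eta> by (intro powr_mono2) (auto simp: incseq_def)
    then have "1 / s (Suc K) \<le> 1 / L m powr \<eta>" using Lm1 by (intro divide_left_mono) (auto simp: s_def intro!: mult_pos_pos Lpos)
    also have "\<dots> = L m powr (- \<eta>)" by (simp add: powr_minus_divide)
    also have "\<dots> \<le> L m powr (- (1 - \<eta>))" using Lm1 \<eta> by (intro powr_mono) auto
    finally show ?thesis using LmS2 by linarith
  qed
  have hol: "\<bar>pullback f \<phi> m (x + t, y) - pullback f \<phi> m (x, y)\<bar> \<le> N' * \<beta>" if t: "0 \<le> t" "t \<le> \<delta>" for x y t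
  proof -
    have lip: "\<bar>f i u - f i v\<bar> \<le> (K\<^sub>0 * L i) * \<bar>u - v\<bar>" if "1 \<le> i" for i u v
    proof -
      have "norm (f i u - f i v) \<le> K\<^sub>0 * L i * norm (u - v)"
        by (rule field_differentiable_bound[of UNIV "f i" "deriv (f i)"])
          (use map_hyps_regular(2,4)[OF hyps[OF that]] in auto)
      then show ?thesis by simp
    qed
    have "\<bar>pullback f \<phi> m (x + t, y) - pullback f \<phi> m (x, y)\<bar> \<le> N' * (2 * A * max \<bar>x + t - x\<bar> \<bar>y - y\<bar>) powr \<alpha>"
      unfolding A_def by (rule pullback_holder[OF \<phi> \<alpha>(1) _ lip]) (use K Lpos in \<open>auto intro: less_imp_le\<close>)
    also have "\<dots> \<le> N' * \<epsilon> powr \<alpha>"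
    proof (intro mult_left_mono powr_mono2)
      have "2 * A * t \<le> 2 * A * \<delta>" using t A1 by (intro mult_left_mono) auto
      also have "\<dots> = \<epsilon>" using A1 by (simp add: \<delta>_def)
      finally show "2 * A * max \<bar>x + t - x\<bar> \<bar>y - y\<bar> \<le> \<epsilon>" using t by simp
    qed (use \<alpha> A1 N in auto)
    finally show ?thesis by (simp add: \<epsilon>\<alpha>)
  qed
  have cuts: "(\<Sum>j<Suc K. integral {0..1} (\<lambda>z. 1 - cut (Suc j) z)) \<le> 9 * real M * K\<^sub>1 * \<beta>"
  proof -
    have "integral {0..1} (\<lambda>z. 1 - cut (Suc j) z) \<le> 9 * real M * K\<^sub>1 * L (m + Suc j) powr ?p" for j
    proof -
      define l where "l = L (m + Suc j)"
      have l: "1 \<le> l" unfolding l_def by (rule L1)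
      \<comment> \<open>The cutoff differs from 1 only where the derivative is below \<open>3/2 * l powr \<eta>\<close>, hence only
          within distance \<open>r\<close> of a critical point.\<close>
      define r where "r = 3 / 2 * K\<^sub>1 * l powr (\<eta> - 1)"
      have r: "0 < r" using l K by (simp add: r_def)
      have "3 / 2 * s (Suc j) = l / K\<^sub>1 * r"
      proof -
        have "l * l powr (\<eta> - 1) = l powr \<eta>" using l by (simp add: powr_diff)
        then show ?thesis using K unfolding s_def r_def l_def[symmetric] by (simp add: field_simps)
      qed
      then have near: "\<exists>c\<in>crit (g (Suc j)). \<exists>k::int. \<bar>x - c - of_int k\<bar> \<le> r"
        if "\<bar>deriv (g (Suc j)) x\<bar> < 3 / 2 * s (Suc j)" for x
        using map_hyps_near_critical[OF gj[of j] Lpos K(2), of x r] that by (simp add: l_def)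
      note C = map_hyps_crit[OF gj[of j]]
      have "integral {0..1} (\<lambda>z. 1 - cut (Suc j) z) \<le> 6 * r * card (crit (g (Suc j)))"
        by (rule cut_defect_integral[OF C(2) C(1) C(4) r near])
      also have "\<dots> \<le> 6 * r * real M" using C(3) r by (intro mult_left_mono) auto
      also have "\<dots> = 9 * real M * K\<^sub>1 * l powr (\<eta> - 1)" by (simp add: r_def)
      also have "\<dots> \<le> 9 * real M * K\<^sub>1 * l powr ?p" using l K \<eta> by (intro mult_left_mono powr_mono) (auto simp: field_simps)
      finally show ?thesis by (simp add: l_def)
    qed
    then have "(\<Sum>j<Suc K. integral {0..1} (\<lambda>z. 1 - cut (Suc j) z)) \<le> (\<Sum>j<Suc K. 9 * real M * K\<^sub>1 * L (m + Suc j) powr ?p)"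
      by (intro sum_mono)
    also have "\<dots> = 9 * real M * K\<^sub>1 * (\<Sum>j<Suc K. L (m + Suc j) powr ?p)" by (simp add: sum_distrib_left distrib_left)
    also have "(\<Sum>j<Suc K. L (m + Suc j) powr ?p) = (\<Sum>i\<in>Suc ` {..<Suc K}. L (m + i) powr ?p)"
      by (subst sum.reindex) auto
    also have "9 * real M * K\<^sub>1 * \<dots> \<le> 9 * real M * K\<^sub>1 * \<beta>"
      using term_le[of "Suc ` {..<Suc K}"] S_\<beta> K by (intro mult_left_mono) auto
    finally show ?thesis .
  qed
  have "torus_fun \<phi>" "\<And>p. \<bar>\<phi> p\<bar> \<le> N'" using \<phi> by (auto simp: torus_holder_def)
  note pull = torus_fun_pullback[of f, OF circ this(1)] pullback_bounded[of \<phi> N', OF this(2)]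
  note bound = fibre_equidistribution[OF \<psi> pull hol \<delta> \<epsilon> \<alpha>(1), of K]
  have NN: "0 \<le> N * N'" using N by simp
  have t1: "N' * \<beta> * (2 * N) = N * N' * (2 * \<beta>)" by simp
  have t2: "N' * (2 * N) * (\<Sum>j<Suc K. integral {0..1} (\<lambda>z. 1 - cut (Suc j) z)) \<le> N * N' * (18 * real M * K\<^sub>1 * \<beta>)"
    using mult_left_mono[OF cuts, of "N' * (2 * N)"] N by (simp add: algebra_simps)
  have t3: "N' * (2 * N * \<epsilon> powr \<alpha>) = N * N' * (2 * \<beta>)" by (simp add: \<epsilon>\<alpha>)
  have t4: "N' * (4 * N / \<epsilon>) * (2 / s (Suc K)) \<le> N * N' * (8 * \<beta>)"
  proof -
    have "N' * (4 * N / \<epsilon>) * (2 / s (Suc K)) = N * N' * (8 * ((1 / s (Suc K)) / \<epsilon>))"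
      by (simp add: mult.commute mult.left_commute)
    also have "(1 / s (Suc K)) / \<epsilon> \<le> S\<^sup>2 / \<epsilon>" using sK \<epsilon> by (intro divide_right_mono) auto
    also have "\<dots> \<le> \<beta>" by (rule S2\<epsilon>)
    finally show ?thesis using NN by (simp add: mult_left_mono)
  qed
  have t5: "2 * N' / \<delta> * (2 * N) * \<rho> \<le> N * N' * (16 * \<beta>)"
  proof -
    have "2 * N' / \<delta> * (2 * N) * \<rho> = N * N' * (8 * (A * \<rho> / \<epsilon>))" using A1 \<epsilon> by (simp add: \<delta>_def field_simps)
    also have "A * \<rho> / \<epsilon> \<le> 2 * S\<^sup>2 / \<epsilon>" using A\<rho> \<epsilon> by (intro divide_right_mono) auto
    also have "\<dots> \<le> 2 * \<beta>" using S2\<epsilon> by simp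
    finally show ?thesis using NN by (simp add: mult_left_mono)
  qed
  have t6: "N' * (2 * N) * ((28 * K\<^sub>0 + 10) * \<sigma> (Suc K)) = N * N' * ((56 * K\<^sub>0 + 20) * \<sigma> (Suc K))"
    by (simp add: algebra_simps)
  have "N * N' * (2 * \<beta>) + N * N' * (18 * real M * K\<^sub>1 * \<beta>) + N * N' * (2 * \<beta>) +
      (N * N' * (8 * \<beta>) + N * N' * (16 * \<beta>) + N * N' * ((56 * K\<^sub>0 + 20) * \<sigma> (Suc K)))
     = N * N' * ((28 + 18 * real M * K\<^sub>1) * \<beta> + (56 * K\<^sub>0 + 20) * \<sigma> (Suc K))"
    by (simp add: algebra_simps)
  with bound t1 t2 t3 t4 t5[unfolded \<rho>_def] t6 show ?thesis unfolding \<beta>_def \<sigma>_def by linarith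
qed

section \<open>Decay of correlations\<close>

lemma torus_holder_fibre_mean:
  assumes \<psi>: "torus_holder N \<alpha> \<psi>" and \<alpha>: "0 < \<alpha>"
  shows "torus_holder N \<alpha> (\<lambda>p. fibre_mean \<psi> (fst p))"
proof -
  have t: "torus_fun \<psi>" and b: "\<And>p. \<bar>\<psi> p\<bar> \<le> N" using \<psi> by (auto simp: torus_holder_def)
  have N: "0 \<le> N" using b[of "(0, 0)"] by linarith
  have "\<bar>fibre_mean \<psi> (fst p) - fibre_mean \<psi> (fst q)\<bar> \<le> N * dist p q powr \<alpha>" for p q
  proof -
    have "\<bar>fibre_mean \<psi> (fst p) - fibre_mean \<psi> (fst q)\<bar> \<le> N * \<bar>fst p - fst q\<bar> powr \<alpha>"
      by (rule fibre_mean_holder[OF \<psi>])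
    also have "\<dots> \<le> N * dist p q powr \<alpha>"
      using dist_fst_le[of p q] \<alpha> N by (intro mult_left_mono powr_mono2) (auto simp: dist_real_def)
    finally show ?thesis .
  qed
  then show ?thesis
    using torus_fun_of_circle_fun(1)[OF circle_fun_fibre_mean[OF t]] fibre_mean_bound[OF t b]
    by (auto simp: torus_holder_def)
qed

text \<open>
  Two applications of \<open>observable_decouples\<close>. At time \<open>n\<close>, it replaces \<open>\<psi>\<close> by its mean over the first
  coordinate, a function of the second coordinate only. At time \<open>n - 1\<close> that function is an
  observable of the first coordinate, and its mean is the integral of \<open>\<psi>\<close>.
\<close>

lemma correlation_decay:
  assumes sys: "system_hyps M K\<^sub>0 K\<^sub>1 L f" and K: "0 < K\<^sub>0" "0 < K\<^sub>1" and \<eta>: "1/2 < \<eta>" "\<eta> < 1"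
    and large: "\<And>i. 1 \<le> i \<Longrightarrow> 64 * (K\<^sub>0 + 1) \<le> L i"
      "\<And>i. 1 \<le> i \<Longrightarrow> (32 * K\<^sub>0 + 16) * L i powr (1 - 2 * \<eta>) \<le> 1"
    and summ: "summable (\<lambda>i. L i powr (- (1/2) * (1 - \<eta>)))"
    and \<alpha>: "0 < \<alpha>" "\<alpha> \<le> 1"
    and \<phi>: "torus_holder N' \<alpha> \<phi>" and \<psi>: "torus_holder N \<alpha> \<psi>"
    and m: "m + 2 \<le> n" "8 * m \<le> n" "1 \<le> h" "h < n"
    and S: "S = (\<Sum>i. L (m + i) powr (- (1/2) * (1 - \<eta>)))" "S < 1"
  shows "\<bar>integral cell (\<lambda>(x, y). \<psi> (orb f x y (Suc n), orb f x y n) * \<phi> (x, y))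
      - integral cell \<phi> * integral cell \<psi>\<bar>
    \<le> N * N' * (2 * ((28 + 18 * real M * K\<^sub>1) * S powr (\<alpha> / (\<alpha> + 2)) + (56 * K\<^sub>0 + 20) * L h powr (1 - 2 * \<eta>)))"
proof -
  define g where "g = (\<lambda>j. f (m + j))"
  obtain k where k: "n = m + Suc (Suc k)" using m(1) by (auto simp: le_iff_add)
  have L0: "0 < L 0" and inc: "incseq L" and hyps: "\<And>n. 1 \<le> n \<Longrightarrow> map_hyps M K\<^sub>0 K\<^sub>1 (L n) (f n)"
    using sys by (auto simp: system_hyps_def)
  have circ: "circle_fun (f (Suc j))" for j by (rule map_hyps_circle_fun[OF hyps]) simp
  have circ_g: "circle_fun (g (Suc j))" for j using circ[of "m + j"] by (simp add: g_def)
  have t: "torus_fun \<psi>" "torus_fun \<phi>" using \<psi> \<phi> by (auto simp: torus_holder_def)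
  define \<Phi> where "\<Phi> = pullback f \<phi> m"
  have t\<Phi>: "torus_fun \<Phi>" unfolding \<Phi>_def by (rule torus_fun_pullback) (use circ t in auto)
  define \<psi>\<^sub>1 where "\<psi>\<^sub>1 = (\<lambda>p::real \<times> real. fibre_mean \<psi> (fst p))"
  have \<psi>1: "torus_holder N \<alpha> \<psi>\<^sub>1" unfolding \<psi>\<^sub>1_def by (rule torus_holder_fibre_mean[OF \<psi> \<alpha>(1)])
  define c where "c = integral cell \<psi>"
  have mean1: "fibre_mean \<psi>\<^sub>1 v = c" for v
    using cell_fubini(2)[of \<psi>] t(1)
    by (simp add: fibre_mean_def[abs_def] \<psi>\<^sub>1_def c_def torus_fun_def)
  have N: "0 \<le> N * N'" using \<phi> \<psi> unfolding torus_holder_def by (meson abs_ge_zero order_trans mult_nonneg_nonneg)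
  have Lh: "L (m + Suc j) powr (1 - 2 * \<eta>) \<le> L h powr (1 - 2 * \<eta>)" if "h \<le> m + Suc j" for j
  proof -
    have "0 < L h" using large(1)[OF m(3)] K(1) mult_pos_pos[of 64 "K\<^sub>0 + 1"] by simp
    then show ?thesis using inc that \<eta> by (intro powr_mono2') (auto simp: incseq_def)
  qed
  let ?B = "N * N' * ((28 + 18 * real M * K\<^sub>1) * S powr (\<alpha> / (\<alpha> + 2)) + (56 * K\<^sub>0 + 20) * L h powr (1 - 2 * \<eta>))"
  have step: "\<bar>integral cell (\<lambda>(x, y). \<Phi> (x, y) *
      (\<theta> (orb g x y (Suc (Suc j)), orb g x y (Suc j)) - fibre_mean \<theta> (orb g x y (Suc j))))\<bar> \<le> ?B"
    if "torus_holder N \<alpha> \<theta>" "6 * m \<le> Suc j" "h \<le> m + Suc j" for \<theta> j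
  proof (rule order_trans)
    show "\<bar>integral cell (\<lambda>(x, y). \<Phi> (x, y) *
      (\<theta> (orb g x y (Suc (Suc j)), orb g x y (Suc j)) - fibre_mean \<theta> (orb g x y (Suc j))))\<bar> \<le>
       N * N' * ((28 + 18 * real M * K\<^sub>1) * S powr (\<alpha> / (\<alpha> + 2)) + (56 * K\<^sub>0 + 20) * L (m + Suc j) powr (1 - 2 * \<eta>))"
      unfolding \<Phi>_def
      by (rule observable_decouples[OF sys K \<eta> large summ \<alpha> \<phi> that(1,2) S g_def])
    show "\<dots> \<le> ?B" using Lh[OF that(3)] N K by (intro mult_left_mono add_left_mono) auto
  qed
  have cont: "continuous_on UNIV (\<lambda>p. \<Phi> p)" using t\<Phi> by (simp add: torus_fun_def)
  have c1: "continuous_on UNIV (\<lambda>p. \<theta> (orb g (fst p) (snd p) (Suc i), orb g (fst p) (snd p) i))"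
    if "torus_fun \<theta>" for \<theta> i
    by (intro torus_fun_cont[OF that] orb_continuous circ_g continuous_intros)
  have c2: "continuous_on UNIV (\<lambda>p. fibre_mean \<psi> (orb g (fst p) (snd p) i))" for i
    by (intro circle_fun_cont[OF circle_fun_fibre_mean[OF t(1)]] orb_continuous circ_g continuous_intros)
  let ?I = "integral cell (\<lambda>p. \<Phi> p * \<psi> (orb g (fst p) (snd p) (Suc (Suc (Suc k))), orb g (fst p) (snd p) (Suc (Suc k))))"
  let ?I1 = "integral cell (\<lambda>p. \<Phi> p * fibre_mean \<psi> (orb g (fst p) (snd p) (Suc (Suc k))))"
  have "integral cell (\<lambda>(x, y). \<Phi> (x, y) *
      (\<psi> (orb g x y (Suc (Suc (Suc k))), orb g x y (Suc (Suc k))) - fibre_mean \<psi> (orb g x y (Suc (Suc k))))) = ?I - ?I1"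
    unfolding case_prod_unfold prod.collapse right_diff_distrib
    by (intro Henstock_Kurzweil_Integration.integral_diff cell_integrable continuous_on_mult cont c1 c2 t)
  moreover have "6 * m \<le> Suc (Suc k)" "h \<le> m + Suc (Suc k)" "6 * m \<le> Suc k" "h \<le> m + Suc k"
    using m k by auto
  ultimately have A: "\<bar>?I - ?I1\<bar> \<le> ?B" using step[OF \<psi>, of "Suc k"] by simp
  have "integral cell (\<lambda>(x, y). \<Phi> (x, y) *
      (\<psi>\<^sub>1 (orb g x y (Suc (Suc k)), orb g x y (Suc k)) - fibre_mean \<psi>\<^sub>1 (orb g x y (Suc k)))) =
      ?I1 - integral cell (\<lambda>p. \<Phi> p * c)"
    unfolding case_prod_unfold prod.collapse right_diff_distrib mean1 unfolding \<psi>\<^sub>1_def fst_conv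
    by (intro Henstock_Kurzweil_Integration.integral_diff cell_integrable continuous_on_mult cont c2 continuous_on_const)
  then have B: "\<bar>?I1 - integral cell \<Phi> * c\<bar> \<le> ?B"
    using step[OF \<psi>1, of k] \<open>6 * m \<le> Suc k\<close> \<open>h \<le> m + Suc k\<close> by simp
  have "integral cell (\<lambda>(x, y). \<psi> (orb f x y (Suc n), orb f x y n) * \<phi> (x, y)) = ?I"
    using cell_integral_transport[of f \<phi> \<psi> m "Suc (Suc k)", OF circ t(2,1)]
    by (simp only: k g_def[symmetric] \<Phi>_def[symmetric] case_prod_unfold prod.collapse mult.commute)
  moreover have "integral cell \<Phi> = integral cell \<phi>"
    using cell_integral_transport[of f \<phi> "\<lambda>_. 1" m 0, OF circ t(2)]
    by (simp add: torus_fun_def \<Phi>_def[symmetric] case_prod_unfold)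
  ultimately show ?thesis using A B unfolding c_def by (simp add: algebra_simps)
qed

theorem theorem3:
  fixes M\<^sub>0 :: nat and K\<^sub>0 K\<^sub>1 \<eta> :: real
  assumes "K\<^sub>0 > 0" and "K\<^sub>1 > 0" and "1/2 < \<eta>" and "\<eta> < 1"
  shows "\<exists>(L\<^sub>0' :: real) (C :: real) (C\<^sub>0 :: real \<Rightarrow> real).
    \<forall>(L :: nat \<Rightarrow> real) (f :: nat \<Rightarrow> real \<Rightarrow> real).
      system_hyps M\<^sub>0 K\<^sub>0 K\<^sub>1 L f \<and> L 1 \<ge> L\<^sub>0' \<and>
      summable (\<lambda>i. L i powr (- (1/2) * (1 - \<eta>))) \<longrightarrow>
      (\<forall>(\<alpha> :: real) (\<phi> :: real \<times> real \<Rightarrow> real) (\<psi> :: real \<times> real \<Rightarrow> real).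
        0 < \<alpha> \<and> \<alpha> \<le> 1 \<and> holder_on_torus \<alpha> \<phi> \<and> holder_on_torus \<alpha> \<psi> \<longrightarrow>
        (\<forall>n :: nat.
          \<bar>torus_integral (\<lambda>p. \<psi> (torus_comp f n p) * \<phi> p)
             - torus_integral \<phi> * torus_integral \<psi>\<bar>
          \<le> (if n \<le> 1 then C\<^sub>0 (L 0) else C) * holder_norm \<alpha> \<psi> * holder_norm \<alpha> \<phi> *
             max (L (n div 2) powr (1 - 2 * \<eta>))
                 ((\<Sum>i. L (n div 8 + i) powr (- (1/2) * (1 - \<eta>))) powr (\<alpha> / (\<alpha> + 2)))))"
proof -
  \<comment> \<open>The first bound lets expansion beat contraction and the second makes the distortion small.\<close>
  define l\<^sub>0 where "l\<^sub>0 = max (64 * (K\<^sub>0 + 1)) ((32 * K\<^sub>0 + 16) powr (1 / (2 * \<eta> - 1)))"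
  define C where "C = 2 * (48 + 18 * real M\<^sub>0 * K\<^sub>1 + 56 * K\<^sub>0)"
  \<comment> \<open>For at most one iteration the bound is trivial, because it contains \<open>L 0 powr (1 - 2 * \<eta>)\<close>.\<close>
  define C\<^sub>0 where "C\<^sub>0 = (\<lambda>l::real. 2 / l powr (1 - 2 * \<eta>))"
  have C2: "2 \<le> C" using assms by (simp add: C_def)
  show ?thesis
  proof (rule exI[of _ l\<^sub>0], rule exI[of _ C], rule exI[of _ C\<^sub>0], intro allI impI, elim conjE)
    fix L :: "nat \<Rightarrow> real" and f :: "nat \<Rightarrow> real \<Rightarrow> real" and \<alpha> :: real and \<phi> \<psi> :: "real \<times> real \<Rightarrow> real" and n :: nat
    assume sys: "system_hyps M\<^sub>0 K\<^sub>0 K\<^sub>1 L f" and L1: "l\<^sub>0 \<le> L 1"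
      and summ: "summable (\<lambda>i. L i powr (- (1/2) * (1 - \<eta>)))"
      and \<alpha>: "0 < \<alpha>" "\<alpha> \<le> 1" and \<phi>: "holder_on_torus \<alpha> \<phi>" and \<psi>: "holder_on_torus \<alpha> \<psi>"
    define N where "N = holder_norm \<alpha> \<psi>"
    define N' where "N' = holder_norm \<alpha> \<phi>"
    define \<Phi> where "\<Phi> = periodic_ext \<phi>"
    define \<Psi> where "\<Psi> = periodic_ext \<psi>"
    have h\<Phi>: "torus_holder N' \<alpha> \<Phi>" and h\<Psi>: "torus_holder N \<alpha> \<Psi>" and N0: "0 \<le> N" "0 \<le> N'"
      using torus_holder_periodic_ext[OF \<phi> \<alpha>(1)] torus_holder_periodic_ext[OF \<psi> \<alpha>(1)]
      by (simp_all add: N_def N'_def \<Phi>_def \<Psi>_def)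
    have t: "torus_fun \<Phi>" "torus_fun \<Psi>" and b: "\<And>p. \<bar>\<Phi> p\<bar> \<le> N'" "\<And>p. \<bar>\<Psi> p\<bar> \<le> N"
      using h\<Phi> h\<Psi> by (auto simp: torus_holder_def)
    have L0: "0 < L 0" and inc: "incseq L" and hyps: "\<And>n. 1 \<le> n \<Longrightarrow> map_hyps M\<^sub>0 K\<^sub>0 K\<^sub>1 (L n) (f n)"
      using sys by (auto simp: system_hyps_def)
    have circ: "circle_fun (f (Suc j))" for j by (rule map_hyps_circle_fun[OF hyps]) simp
    have ext: "\<theta> p = periodic_ext \<theta> p" if "p \<in> torus" for \<theta> p
      using that by (cases p) (auto simp: periodic_ext_def torus_def circle_def frac_eq)
    have cont: "continuous_on UNIV \<Phi>" "continuous_on UNIV \<Psi>" using t by (auto simp: torus_fun_def)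
    have int: "torus_integral \<phi> = integral cell \<Phi>" "torus_integral \<psi> = integral cell \<Psi>"
      using torus_integral_eq_cell[OF cont(1)] torus_integral_eq_cell[OF cont(2)] ext
      unfolding \<Phi>_def \<Psi>_def by blast+
    define Z where "Z = (\<lambda>(x, y). \<Psi> (orb f x y (Suc n), orb f x y n) * \<Phi> (x, y))"
    have cZ: "continuous_on UNIV Z"
      unfolding Z_def case_prod_unfold
      by (intro continuous_on_mult torus_fun_cont[OF t(1)] torus_fun_cont[OF t(2)] orb_continuous circ continuous_intros)
    have intZ: "torus_integral (\<lambda>p. \<psi> (torus_comp f n p) * \<phi> p) = integral cell Z"
    proof (rule torus_integral_eq_cell[OF cZ])
      fix p assume p: "p \<in> torus"
      obtain x y where xy: "p = (x, y)" by (cases p)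
      show "\<psi> (torus_comp f n p) * \<phi> p = Z p"
        using p torus_comp_eq_orb[of f x y n, OF circ] ext[OF p, of \<phi>] unfolding xy
        by (simp add: Z_def \<Psi>_def \<Phi>_def periodic_ext_def del: orb.simps)
    qed
    have triv: "\<bar>integral cell Z - integral cell \<Phi> * integral cell \<Psi>\<bar> \<le> 2 * N * N'"
    proof -
      have "\<bar>integral cell Z\<bar> \<le> integral cell (\<lambda>_. N * N')"
        by (intro cell_bound cZ continuous_intros) (auto simp: Z_def abs_mult N0 intro!: mult_mono b)
      moreover have "\<bar>integral cell \<Phi>\<bar> \<le> integral cell (\<lambda>_. N')"
        by (intro cell_bound cont continuous_intros b)
      moreover have "\<bar>integral cell \<Psi>\<bar> \<le> integral cell (\<lambda>_. N)"
        by (intro cell_bound cont continuous_intros b)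
      ultimately have *: "\<bar>integral cell Z\<bar> \<le> N * N'" "\<bar>integral cell \<Phi>\<bar> \<le> N'" "\<bar>integral cell \<Psi>\<bar> \<le> N"
        by (simp_all only: cell_const)
      have "\<bar>integral cell \<Phi> * integral cell \<Psi>\<bar> \<le> N' * N"
        unfolding abs_mult using * N0 by (intro mult_mono) auto
      then show ?thesis using *(1) by (simp add: mult.commute)
    qed
    define S where "S = (\<Sum>i. L (n div 8 + i) powr (- (1/2) * (1 - \<eta>)))"
    define B where "B = max (L (n div 2) powr (1 - 2 * \<eta>)) (S powr (\<alpha> / (\<alpha> + 2)))"
    have B0: "0 \<le> B" by (simp add: B_def le_max_iff_disj)
    have NN: "0 \<le> N * N'" using N0 by simp
    have "\<bar>integral cell Z - integral cell \<Phi> * integral cell \<Psi>\<bar> \<le> (if n \<le> 1 then C\<^sub>0 (L 0) else C) * N * N' * B"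
    proof (cases "n \<le> 1")
      case True
      then have "L 0 powr (1 - 2 * \<eta>) \<le> B" by (simp add: B_def)
      then have "C\<^sub>0 (L 0) * L 0 powr (1 - 2 * \<eta>) \<le> C\<^sub>0 (L 0) * B" by (intro mult_left_mono) (auto simp: C\<^sub>0_def)
      then have "2 \<le> C\<^sub>0 (L 0) * B" using L0 by (simp add: C\<^sub>0_def)
      from mult_right_mono[OF this NN] show ?thesis using triv True by (simp add: algebra_simps)
    next
      case n: False
      show ?thesis
      proof (cases "S < 1")
        case False
        then have "1 \<le> S powr (\<alpha> / (\<alpha> + 2))" using \<alpha> by (intro ge_one_powr_ge_zero) auto
        then have "1 \<le> B" by (simp add: B_def le_max_iff_disj)
        then have "2 * 1 \<le> C * B" using C2 by (intro mult_mono) auto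
        then have "2 \<le> C * B" by simp
        from mult_right_mono[OF this NN] show ?thesis using triv n by (simp add: algebra_simps)
      next
        case S1: True
        have large: "64 * (K\<^sub>0 + 1) \<le> L i" "(32 * K\<^sub>0 + 16) * L i powr (1 - 2 * \<eta>) \<le> 1" if "1 \<le> i" for i
        proof -
          have Li: "l\<^sub>0 \<le> L i" using L1 inc that by (meson incseq_def order_trans)
          then show "64 * (K\<^sub>0 + 1) \<le> L i" by (simp add: l\<^sub>0_def)
          let ?q = "32 * K\<^sub>0 + 16"
          have q: "0 < ?q" using assms by simp
          have "L i powr (1 - 2 * \<eta>) \<le> (?q powr (1 / (2 * \<eta> - 1))) powr (1 - 2 * \<eta>)"
            using Li assms q by (intro powr_mono2') (auto simp: l\<^sub>0_def)
          also have "\<dots> = ?q powr (- 1)"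
          proof -
            have "1 / (2 * \<eta> - 1) * (1 - 2 * \<eta>) = - 1" using assms by (simp add: field_simps)
            then show ?thesis unfolding powr_powr by simp
          qed
          also have "\<dots> = 1 / ?q" using q by (simp add: powr_minus_divide)
          finally show "?q * L i powr (1 - 2 * \<eta>) \<le> 1" using q by (simp add: field_simps)
        qed
        have "n div 8 + 2 \<le> n" "8 * (n div 8) \<le> n" "1 \<le> n div 2" "n div 2 < n" using n by auto
        from correlation_decay[OF sys assms large summ \<alpha> h\<Phi> h\<Psi> this S_def S1]
        have "\<bar>integral cell Z - integral cell \<Phi> * integral cell \<Psi>\<bar> \<le>
          N * N' * (2 * ((28 + 18 * real M\<^sub>0 * K\<^sub>1) * S powr (\<alpha> / (\<alpha> + 2)) + (56 * K\<^sub>0 + 20) * L (n div 2) powr (1 - 2 * \<eta>)))"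
          unfolding Z_def .
        also have "\<dots> \<le> N * N' * (2 * ((28 + 18 * real M\<^sub>0 * K\<^sub>1) * B + (56 * K\<^sub>0 + 20) * B))"
          using assms by (intro mult_left_mono add_mono NN) (auto simp: B_def)
        also have "\<dots> = C * N * N' * B" by (simp add: C_def algebra_simps)
        finally show ?thesis using n by simp
      qed
    qed
    then show "\<bar>torus_integral (\<lambda>p. \<psi> (torus_comp f n p) * \<phi> p) - torus_integral \<phi> * torus_integral \<psi>\<bar>
          \<le> (if n \<le> 1 then C\<^sub>0 (L 0) else C) * holder_norm \<alpha> \<psi> * holder_norm \<alpha> \<phi> *
             max (L (n div 2) powr (1 - 2 * \<eta>))
                 ((\<Sum>i. L (n div 8 + i) powr (- (1/2) * (1 - \<eta>))) powr (\<alpha> / (\<alpha> + 2)))"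
      unfolding intZ int B_def S_def N_def N'_def .
  qed
qed

end
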